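(* Suppose $G$ is a finite $p$-group ($p$ a prime) with lower $p$-length $n$. Let $g_i=\dim(G_i/G_{i+1})$ for $i=1,\dots,n$. Suppose $u_1,\dots,u_n$ are integers satisfying $0\le u_i\le g_i$ for all $i=1,\dots,n$, and let $$S(G,u_1,\dots,u_n)=\{U\lhd G : \dim((U\cap G_i)G_{i+1}/G_{i+1})=u_i \text{ for } i=1,\dots,n\}.$$ Let $v_1,\dots,v_n$ and $w_1,\dots,w_n$ be integers such that for each $U\in S(G,u_1,\dots,u_n)$ and $1\le i\le n$, $$\dim((U_2\cap G_i)G_{i+1}/G_{i+1})\ge v_i \quad\text{and}\quad \dim((U^p[U,G]\cap G_i)G_{i+1}/G_{i+1})\ge w_i.$$ Then $$|S(G,u_1,\dots,u_n)|\le \genfrac{[}{]}{0pt}{}{g_1}{u_1}_p\prod_{i=2}^n \genfrac{[}{]}{0pt}{}{g_i-w_i}{u_i-w_i}_p\, p^{(g_i-u_i)(u_1+\cdots+u_{i-1}-v_1-\cdots-v_{i-1})}.$$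
   Context: The lower $p$-series of a group $G$ is $G_1=G$, $G_{i+1}=G_i^p[G_i,G]$, where $H^p$ denotes the subgroup generated by $p$-th powers of elements of $H$. $G$ has lower $p$-length $n$ if $G_n$ is the last non-identity term. The quotients $G_i/G_{i+1}$ are elementary abelian $p$-groups, and dimensions are as $\mathbb{F}_p$-vector spaces. $U_2=U^p[U,U]$ is the second term of the lower $p$-series of $U$. The Gaussian coefficient $\genfrac{[}{]}{0pt}{}{m}{k}_q$ is the number of $k$-dimensional subspaces of an $m$-dimensional $\mathbb{F}_q$-vector space (and is $0$ when $k<0$ or $k>m$). *)

theory Defs
  imports
    "HOL-Algebra.Coset"
    "HOL-Algebra.Generated_Groups"
    "HOL-Number_Theory.Residues"
    "Jordan_Normal_Form.Missing_VectorSpace"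
begin

section \<open>Groups of exponent \<open>p\<close> as \<open>\<F>\<^sub>p\<close>-vector spaces\<close>

text \<open>The vector addition is the group operation of \<open>A\<close>, and a scalar acts by taking powers.
  The ring operations \<open>mult\<close> and \<open>one\<close> inherited from the record type play no role.\<close>

definition Fp_space :: "('a, 'b) monoid_scheme \<Rightarrow> (int, 'a) module" where
  "Fp_space A =
    \<lparr>carrier = carrier A,
     monoid.mult = (\<lambda>_ _. \<one>\<^bsub>A\<^esub>),
     one = \<one>\<^bsub>A\<^esub>,
     zero = \<one>\<^bsub>A\<^esub>,
     add = (\<lambda>x y. x \<otimes>\<^bsub>A\<^esub> y),
     smult = (\<lambda>c x. x [^]\<^bsub>A\<^esub> c)\<rparr>"

lemma Fp_space_vectorspace:
  assumes p: "Factorial_Ring.prime (p::nat)" and A: "comm_group A"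
    and exp: "\<And>x. x \<in> carrier A \<Longrightarrow> x [^]\<^bsub>A\<^esub> p = \<one>\<^bsub>A\<^esub>"
  shows "vectorspace (residue_ring (int p)) (Fp_space A)"
proof -
  interpret A: comm_group A by (rule A)
  interpret R: residues_prime p "residue_ring (int p)"
    by unfold_locales (use p in auto)
  have modp: "x [^]\<^bsub>A\<^esub> (c mod int p) = x [^]\<^bsub>A\<^esub> c" if "x \<in> carrier A" for x and c :: int
  proof -
    have "x [^]\<^bsub>A\<^esub> c = x [^]\<^bsub>A\<^esub> (int p * (c div int p) + c mod int p)"
      by simp
    also have "\<dots> = (x [^]\<^bsub>A\<^esub> int p) [^]\<^bsub>A\<^esub> (c div int p) \<otimes>\<^bsub>A\<^esub> x [^]\<^bsub>A\<^esub> (c mod int p)"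
      using that by (simp only: A.int_pow_mult A.int_pow_pow)
    also have "x [^]\<^bsub>A\<^esub> int p = \<one>\<^bsub>A\<^esub>"
      using exp[OF that] by (simp add: int_pow_int)
    finally show ?thesis using that by simp
  qed
  have "Module.module (residue_ring (int p)) (Fp_space A)"
  proof (rule module_criteria)
    show "cring (residue_ring (int p))" by (rule R.cring)
    show "\<forall>v\<in>carrier (Fp_space A). \<exists>w\<in>carrier (Fp_space A).
            v \<oplus>\<^bsub>Fp_space A\<^esub> w = \<zero>\<^bsub>Fp_space A\<^esub>"
      using A.r_inv by (fastforce simp: Fp_space_def)
  qed (auto simp: Fp_space_def residue_ring_def modp A.m_ac A.int_pow_mult A.int_pow_distrib
        A.int_pow_pow mult.commute)
  then show ?thesis
    unfolding vectorspace_def using R.is_field by blast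
qed

text \<open>Dimension over \<open>\<F>\<^sub>p\<close> of the section \<open>H/N\<close> of \<open>G\<close>; meant for
  \<open>N \<lhd> H \<le> G\<close> with \<open>H/N\<close> elementary abelian.\<close>

definition section_dim :: "('a, 'b) monoid_scheme \<Rightarrow> nat \<Rightarrow> 'a set \<Rightarrow> 'a set \<Rightarrow> nat" where
  "section_dim G p H N =
    vectorspace.dim (residue_ring (int p)) (Fp_space ((G\<lparr>carrier := H\<rparr>) Mod N))"


section \<open>The lower \<open>p\<close>-series\<close>

definition power_subgroup :: "('a, 'b) monoid_scheme \<Rightarrow> nat \<Rightarrow> 'a set \<Rightarrow> 'a set" where
  "power_subgroup G p H = generate G ((\<lambda>x. x [^]\<^bsub>G\<^esub> p) ` H)"

definition commutator_subgroup :: "('a, 'b) monoid_scheme \<Rightarrow> 'a set \<Rightarrow> 'a set \<Rightarrow> 'a set" where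
  "commutator_subgroup G H K =
    generate G (\<Union>h\<in>H. \<Union>k\<in>K. {h \<otimes>\<^bsub>G\<^esub> k \<otimes>\<^bsub>G\<^esub> inv\<^bsub>G\<^esub> h \<otimes>\<^bsub>G\<^esub> inv\<^bsub>G\<^esub> k})"

definition power_commutator :: "('a, 'b) monoid_scheme \<Rightarrow> nat \<Rightarrow> 'a set \<Rightarrow> 'a set \<Rightarrow> 'a set" where
  "power_commutator G p H K = power_subgroup G p H <#>\<^bsub>G\<^esub> commutator_subgroup G H K"

text \<open>The series starts at index \<open>1\<close>; the value at index \<open>0\<close> is a dummy.\<close>

fun lower_p_series :: "('a, 'b) monoid_scheme \<Rightarrow> nat \<Rightarrow> nat \<Rightarrow> 'a set" where
  "lower_p_series G p 0 = carrier G"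
| "lower_p_series G p (Suc 0) = carrier G"
| "lower_p_series G p (Suc (Suc i)) =
     power_commutator G p (lower_p_series G p (Suc i)) (carrier G)"

definition lower_p_length :: "('a, 'b) monoid_scheme \<Rightarrow> nat \<Rightarrow> nat \<Rightarrow> bool" where
  "lower_p_length G p n \<longleftrightarrow>
    1 \<le> n \<and> lower_p_series G p n \<noteq> {\<one>\<^bsub>G\<^esub>} \<and> (\<forall>i>n. lower_p_series G p i = {\<one>\<^bsub>G\<^esub>})"

text \<open>\<open>dim((H \<inter> G\<^sub>i)G\<^sub>i\<^sub>+\<^sub>1/G\<^sub>i\<^sub>+\<^sub>1)\<close>\<close>

definition layer_dim :: "('a, 'b) monoid_scheme \<Rightarrow> nat \<Rightarrow> 'a set \<Rightarrow> nat \<Rightarrow> nat" where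
  "layer_dim G p H i =
    section_dim G p ((H \<inter> lower_p_series G p i) <#>\<^bsub>G\<^esub> lower_p_series G p (i + 1))
      (lower_p_series G p (i + 1))"

definition normal_subgroups_with_layers ::
    "('a, 'b) monoid_scheme \<Rightarrow> nat \<Rightarrow> nat \<Rightarrow> (nat \<Rightarrow> int) \<Rightarrow> 'a set set" where
  "normal_subgroups_with_layers G p n u =
    {U. U \<lhd> G \<and> (\<forall>i\<in>{1..n}. int (layer_dim G p U i) = u i)}"


section \<open>Gaussian coefficients\<close>

text \<open>For prime \<open>p\<close>, the number of \<open>k\<close>-dimensional subspaces of the coordinate space \<open>\<F>\<^sub>p\<^sup>m\<close>, realised as
  the space of functions from \<open>{..<m}\<close> to \<open>\<F>\<^sub>p\<close>.\<close>

definition gaussian_coeff :: "nat \<Rightarrow> int \<Rightarrow> int \<Rightarrow> nat" where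
  "gaussian_coeff p m k =
    (if k < 0 \<or> k > m then 0
     else let K = residue_ring (int p); V = ring.func_space K {..<nat m}
          in card {W. subspace K W V \<and> vectorspace.dim K (V\<lparr>carrier := W\<rparr>) = nat k})"

end

theory Submission
  imports Defs
    "HOL-Algebra.SndIsomorphismGrp"
begin

text \<open>
  Write \<open>G\<^sub>i\<close> for the terms of the lower \<open>p\<close>-series and let \<open>S\<close> be the set of normal subgroups to be counted.
  The idea is to approximate \<open>U \<in> S\<close> by the chain of its products \<open>UG\<^sub>2 \<ge> UG\<^sub>3 \<ge> \<dots> \<ge> UG\<^sub>n\<^sub>+\<^sub>1 = U\<close> and to bound, for
  each \<open>i\<close>, the number of ways in which a product \<open>T = UG\<^sub>i\<close> can be refined to \<open>C = UG\<^sub>i\<^sub>+\<^sub>1\<close>. The first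
  product \<open>UG\<^sub>2\<close> is a \<open>u\<^sub>1\<close>-dimensional subspace of \<open>G/G\<^sub>2\<close>, and this accounts for the leading Gaussian
  coefficient (\<open>card_images_base\<close>).

  The refinement step (\<open>card_images_step\<close>) rests on the fact that \<open>G\<^sub>i/G\<^sub>i\<^sub>+\<^sub>1\<close> is central of exponent \<open>p\<close> in
  \<open>G/G\<^sub>i\<^sub>+\<^sub>1\<close>. Consequently \<open>p\<close>-th powers and commutators modulo \<open>G\<^sub>i\<^sub>+\<^sub>1\<close> do not change when their arguments
  are multiplied by elements of \<open>G\<^sub>i\<close>, so \<open>T\<close> determines \<open>T\<^sup>p[T,G]\<close> modulo \<open>G\<^sub>i\<^sub>+\<^sub>1\<close> and every refinement \<open>C\<close>
  contains it (\<open>power_commutator_set_mult_central\<close>). Therefore \<open>M = C \<inter> G\<^sub>i\<close> gives a \<open>u\<^sub>i\<close>-dimensional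
  subspace of \<open>G\<^sub>i/G\<^sub>i\<^sub>+\<^sub>1\<close> that contains a known subspace of dimension at least \<open>w\<^sub>i\<close>, which leaves at most a
  Gaussian coefficient of possibilities
  (\<open>card_intermediate_subgroups_le_gaussian_coeff\<close>, \<open>gaussian_coeff_mono_add\<close>).

  For fixed \<open>T\<close> and \<open>M\<close> the group \<open>C/M\<close> is a complement of the central section \<open>G\<^sub>i/M\<close> in \<open>T/M\<close>. Complements
  of a central subgroup are graphs of homomorphisms from one of them into that subgroup, and here the
  target has exponent \<open>p\<close> and order \<open>p ^ (g\<^sub>i - u\<^sub>i)\<close>. If \<open>C = UG\<^sub>i\<^sub>+\<^sub>1\<close>, a homomorphism from \<open>C/M\<close> kills \<open>U\<^sub>2\<close>,
  so it is determined by its values on generators of \<open>C\<close> modulo \<open>U\<^sub>2M\<close>. The index of \<open>U\<^sub>2M\<close> in \<open>C\<close> is a power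
  \<open>p ^ d\<close>, and \<open>d\<close> generators suffice. Comparing orders along the series
  (\<open>card_set_mult_lower_p_series\<close>), \<open>d\<close> is the sum over \<open>j < i\<close> of \<open>u\<^sub>j\<close> minus the \<open>j\<close>-th layer
  dimension of \<open>U\<^sub>2\<close>, hence at most the sum of the \<open>u\<^sub>j - v\<^sub>j\<close>
  (\<open>card_complements_le\<close>, \<open>card_lifts_with_intersection_le\<close>).

  Throughout, dimensions are converted to orders of subgroups as early as possible: a section of
  dimension \<open>d\<close> has \<open>p ^ d\<close> elements (\<open>card_p_central\<close>), and the remaining argument is about orders.
\<close>

section \<open>Vector spaces over \<open>\<F>\<^sub>p\<close> and Gaussian coefficients\<close>

lemma card_carrier_residue_ring: "card (carrier (residue_ring (int p))) = p"
  by (simp add: residue_ring_def)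

lemma (in vectorspace) fin_dim_if_finite: "finite (carrier V) \<Longrightarrow> fin_dim"
  unfolding fin_dim_def
  using in_own_span[of "carrier V"] span_is_subset2[of "carrier V"] by blast

lemma (in vectorspace) basis_bij_betw_lincomb:
  assumes "finite B" "basis B"
  shows "bij_betw (\<lambda>a. lincomb a B) (B \<rightarrow>\<^sub>E carrier K) (carrier V)"
proof -
  have B: "B \<subseteq> carrier V" using assms(2) by (simp add: basis_def)
  have ex1: "\<exists>!a. a \<in> B \<rightarrow>\<^sub>E carrier K \<and> lincomb a B = v" if "v \<in> carrier V" for v
    using basis_criterion[OF assms(1) B] assms(2) that by blast
  have cl: "lincomb a B \<in> carrier V" if "a \<in> B \<rightarrow>\<^sub>E carrier K" for a
    using that B by (intro lincomb_closed) auto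
  show ?thesis
  proof (rule bij_betwI')
    fix a b assume "a \<in> B \<rightarrow>\<^sub>E carrier K" "b \<in> B \<rightarrow>\<^sub>E carrier K"
    then show "(lincomb a B = lincomb b B) = (a = b)"
      using ex1 cl by blast
  next
    fix v assume "v \<in> carrier V"
    then show "\<exists>a\<in>B \<rightarrow>\<^sub>E carrier K. v = lincomb a B" using ex1 by blast
  qed (rule cl)
qed

lemma (in vectorspace) card_eq_power_dim:
  assumes "finite (carrier V)"
  shows "card (carrier V) = card (carrier K) ^ dim"
proof -
  obtain B where B: "finite B" "basis B"
    using finite_basis_exists fin_dim_if_finite[OF assms] by blast
  have "card (carrier V) = card (B \<rightarrow>\<^sub>E carrier K)"
    using basis_bij_betw_lincomb[OF B] by (simp add: bij_betw_same_card)
  also have "\<dots> = card (carrier K) ^ dim"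
    using B by (simp add: card_PiE dim_basis)
  finally show ?thesis .
qed

text \<open>Number a basis by the indices below \<open>m\<close>; the map from coordinate vectors to linear combinations is
  then a linear isomorphism.\<close>

lemma (in vectorspace) ex_linear_iso_func_space:
  assumes "finite (carrier V)" and "dim = m"
  shows "\<exists>T. linear_map K (func_space {..<m}) V T \<and>
           bij_betw T (carrier (func_space {..<m})) (carrier V)"
proof -
  obtain B where B: "finite B" "basis B"
    using finite_basis_exists fin_dim_if_finite[OF assms(1)] by blast
  have BV: "B \<subseteq> carrier V" using B by (simp add: basis_def)
  have "card B = m" using B assms(2) by (simp add: dim_basis)
  then obtain e where e: "bij_betw e B {..<m}"
    using B(1) by (metis card_lessThan finite_lessThan finite_same_card_bij)
  let ?F = "func_space {..<m} :: ('a, nat \<Rightarrow> 'a) module"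
  define T where "T f = lincomb (\<lambda>v. f (e v)) B" for f
  have em: "e v < m" if "v \<in> B" for v using e that by (auto dest: bij_betwE)
  have fK: "(\<lambda>v. f (e v)) \<in> B \<rightarrow> carrier K" if "f \<in> carrier ?F" for f
    using that em by (auto simp: func_space_def)
  have hom: "T \<in> module_hom K ?F V"
    unfolding module_hom_def
  proof (intro CollectI conjI allI impI)
    show "T \<in> carrier ?F \<rightarrow> carrier V"
      unfolding T_def using lincomb_closed[OF BV fK] by (rule Pi_I)
  next
    fix f g assume "f \<in> carrier ?F \<and> g \<in> carrier ?F"
    then have fg: "f \<in> carrier ?F" "g \<in> carrier ?F" by auto
    have "T (f \<oplus>\<^bsub>?F\<^esub> g) = lincomb (\<lambda>v. f (e v) \<oplus>\<^bsub>K\<^esub> g (e v)) B"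
      unfolding T_def
      by (rule lincomb_cong[OF refl BV])
        (use fK[OF fg(1)] fK[OF fg(2)] em in \<open>simp_all add: func_space_def Pi_iff\<close>)
    also have "\<dots> = T f \<oplus>\<^bsub>V\<^esub> T g"
      unfolding T_def by (rule lincomb_sum[OF B(1) BV fK[OF fg(1)] fK[OF fg(2)]])
    finally show "T (f \<oplus>\<^bsub>?F\<^esub> g) = T f \<oplus>\<^bsub>V\<^esub> T g" .
  next
    fix c f assume "c \<in> carrier K \<and> f \<in> carrier ?F"
    then have c: "c \<in> carrier K" and f: "f \<in> carrier ?F" by auto
    have "T (c \<odot>\<^bsub>?F\<^esub> f) = lincomb (\<lambda>v. c \<otimes>\<^bsub>K\<^esub> f (e v)) B"
      unfolding T_def
      by (rule lincomb_cong[OF refl BV])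
        (use fK[OF f] em c in \<open>simp_all add: func_space_def Pi_iff\<close>)
    also have "\<dots> = c \<odot>\<^bsub>V\<^esub> T f"
      unfolding T_def by (rule lincomb_smult[OF BV fK[OF f] c])
    finally show "T (c \<odot>\<^bsub>?F\<^esub> f) = c \<odot>\<^bsub>V\<^esub> T f" .
  qed
  have lin: "linear_map K ?F V T"
    by (intro linear_map.intro mod_hom.intro mod_hom_axioms.intro func_space_is_vs
        func_space_is_module vectorspace_axioms module_axioms hom)
  have inv: "inv_into B e i \<in> B" if "i < m" for i
    using bij_betwE[OF bij_betw_inv_into[OF e]] that by simp
  have reindex: "bij_betw (\<lambda>f. restrict (f \<circ> e) B) ({..<m} \<rightarrow>\<^sub>E carrier K) (B \<rightarrow>\<^sub>E carrier K)"
  proof (rule bij_betw_byWitness[where f' = "\<lambda>a. restrict (a \<circ> inv_into B e) {..<m}"])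
    show "\<forall>f\<in>{..<m} \<rightarrow>\<^sub>E carrier K. restrict (restrict (f \<circ> e) B \<circ> inv_into B e) {..<m} = f"
    proof (intro ballI ext)
      fix f i assume "f \<in> {..<m} \<rightarrow>\<^sub>E carrier K"
      from PiE_arb[OF this, of i]
      show "restrict (restrict (f \<circ> e) B \<circ> inv_into B e) {..<m} i = f i"
        by (cases "i < m") (simp_all add: inv bij_betw_inv_into_right[OF e])
    qed
    show "\<forall>a\<in>B \<rightarrow>\<^sub>E carrier K. restrict (restrict (a \<circ> inv_into B e) {..<m} \<circ> e) B = a"
    proof (intro ballI ext)
      fix a v assume "a \<in> B \<rightarrow>\<^sub>E carrier K"
      from PiE_arb[OF this, of v]
      show "restrict (restrict (a \<circ> inv_into B e) {..<m} \<circ> e) B v = a v"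
        by (cases "v \<in> B") (simp_all add: em bij_betw_inv_into_left[OF e])
    qed
  qed (use inv em in \<open>auto intro!: restrict_PiE_iff[THEN iffD2]\<close>)
  define L where "L = (\<lambda>a. lincomb a B) \<circ> (\<lambda>f. restrict (f \<circ> e) B)"
  have cF: "carrier ?F = {..<m} \<rightarrow>\<^sub>E carrier K" by (simp add: func_space_def)
  have bij: "bij_betw L (carrier ?F) (carrier V)"
    unfolding L_def cF by (rule bij_betw_trans[OF reindex basis_bij_betw_lincomb[OF B]])
  have "L f = T f" if "f \<in> carrier ?F" for f
    unfolding T_def L_def comp_def by (rule lincomb_cong[OF refl BV _ fK[OF that]]) simp
  then have "bij_betw L (carrier ?F) (carrier V) = bij_betw T (carrier ?F) (carrier V)"
    by (rule bij_betw_cong)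
  with bij have "bij_betw T (carrier ?F) (carrier V)" by (rule iffD1[rotated])
  with lin show ?thesis by blast
qed

lemma (in linear_map) subspace_vimage:
  assumes "subspace K S W"
  shows "subspace K {v \<in> carrier V. T v \<in> S} V"
proof -
  have S: "submodule K S W" using assms by (simp only: subspace_def)
  have "submodule K {v \<in> carrier V. T v \<in> S} V"
  proof
    show "{v \<in> carrier V. T v \<in> S} \<subseteq> carrier V" by blast
    show "\<zero>\<^bsub>V\<^esub> \<in> {v \<in> carrier V. T v \<in> S}"
      using submodule.zero_closed[OF S] T0_is_0 by simp
  next
    fix v w assume "v \<in> {v \<in> carrier V. T v \<in> S}" "w \<in> {v \<in> carrier V. T v \<in> S}"
    then show "v \<oplus>\<^bsub>V\<^esub> w \<in> {v \<in> carrier V. T v \<in> S}"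
      using submodule.m_closed[OF S] T_add by simp
  next
    fix c v assume "c \<in> carrier K" "v \<in> {v \<in> carrier V. T v \<in> S}"
    then show "c \<odot>\<^bsub>V\<^esub> v \<in> {v \<in> carrier V. T v \<in> S}"
      using submodule.smult_closed[OF S] T_smult by simp
  qed
  with V.vectorspace_axioms show ?thesis by (simp only: subspace_def)
qed

lemma subspace_carrier_subset: "subspace K W V \<Longrightarrow> W \<subseteq> carrier V"
  by (simp add: subspace_def submodule_def)

text \<open>Over \<open>\<F>\<^sub>p\<close> a space of dimension \<open>k\<close> has \<open>p ^ k\<close> elements, so subspaces can be sorted by their
  number of elements; this is the form in which they are compared with subgroups. Both sides vanish
  for \<open>k > m\<close>.\<close>

lemma gaussian_coeff_eq_card:
  assumes p: "Factorial_Ring.prime p"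
  shows "gaussian_coeff p (int m) (int k) =
    card {W. subspace (residue_ring (int p)) W (ring.func_space (residue_ring (int p)) {..<m})
           \<and> card W = p ^ k}"
proof -
  define K where "K = residue_ring (int p)"
  interpret R: residues_prime p "residue_ring (int p)"
    by unfold_locales (use p in auto)
  have cK: "cring K" unfolding K_def by (rule R.cring)
  have rK: "ring K" using cK by (simp add: cring_def)
  have fK: "field K" unfolding K_def by (rule R.is_field)
  have card_K: "card (carrier K) = p" unfolding K_def by (rule card_carrier_residue_ring)
  have p1: "1 < p" using p by (rule prime_gt_1_nat)
  have finK: "finite (carrier K)" unfolding K_def by (simp add: residue_ring_def)
  let ?F = "ring.func_space K {..<m}"
  have "Module.module K ?F" by (rule cring.func_space_is_module[OF cK])
  then interpret F: vectorspace K ?F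
    using fK by (simp add: vectorspace_def)
  have cF: "carrier ?F = {..<m} \<rightarrow>\<^sub>E carrier K" by (simp add: ring.func_space_def[OF rK])
  have finF: "finite (carrier ?F)" unfolding cF using finK by (simp add: finite_PiE)
  have card_F: "card (carrier ?F) = p ^ m" unfolding cF by (simp add: card_PiE card_K)
  have dim: "card W = p ^ vectorspace.dim K (F.vs W)" if "subspace K W ?F" for W
    using vectorspace.card_eq_power_dim[OF F.subspace_is_vs[OF that]] card_K
      finite_subset[OF subspace_carrier_subset[OF that] finF] by simp
  have eq: "{W. subspace K W ?F \<and> vectorspace.dim K (F.vs W) = k} =
            {W. subspace K W ?F \<and> card W = p ^ k}"
    using dim power_inject_exp[OF p1] by auto
  show ?thesis
  proof (cases "k \<le> m")
    case True
    then have "gaussian_coeff p (int m) (int k) =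
        card {W. subspace K W ?F \<and> vectorspace.dim K (F.vs W) = k}"
      by (simp add: gaussian_coeff_def Let_def K_def)
    then show ?thesis unfolding eq unfolding K_def .
  next
    case False
    have "card W \<le> p ^ m" if "subspace K W ?F" for W
      using card_mono[OF finF subspace_carrier_subset[OF that]] card_F by simp
    moreover have "p ^ m < p ^ k" using False p1 by simp
    ultimately have "{W. subspace K W ?F \<and> card W = p ^ k} = {}" by force
    then show ?thesis using False unfolding K_def by (simp only: gaussian_coeff_def) simp
  qed
qed

text \<open>Scalars act by powers, so a subgroup is closed under them.\<close>

lemma subspace_Fp_space:
  assumes p: "Factorial_Ring.prime (p::nat)" and A: "comm_group A"
    and exp: "\<And>x. x \<in> carrier A \<Longrightarrow> x [^]\<^bsub>A\<^esub> p = \<one>\<^bsub>A\<^esub>"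
    and W: "subgroup W A"
  shows "subspace (residue_ring (int p)) W (Fp_space A)"
proof -
  interpret A: comm_group A by (rule A)
  have V: "vectorspace (residue_ring (int p)) (Fp_space A)"
    by (rule Fp_space_vectorspace[OF p A exp])
  then have "Module.module (residue_ring (int p)) (Fp_space A)"
    by (simp add: vectorspace_def)
  moreover have "x [^]\<^bsub>A\<^esub> (c::int) \<in> W" if "x \<in> W" for x c
    using A.subgroup_int_pow_closed[OF W that] .
  ultimately show ?thesis
    unfolding subspace_def submodule_def using V
    by (auto simp: Fp_space_def subgroup.subset[OF W] subgroup.m_closed[OF W]
        subgroup.one_closed[OF W] subgroup.mem_carrier[OF W])
qed

text \<open>An abelian group of exponent \<open>p\<close> and order \<open>p ^ m\<close> is a copy of \<open>\<F>\<^sub>p\<^sup>m\<close>, and pulling back along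
  an isomorphism turns its subgroups into subspaces injectively.\<close>

lemma card_subgroups_le_gaussian_coeff:
  assumes p: "Factorial_Ring.prime (p::nat)" and A: "comm_group A"
    and exp: "\<And>x. x \<in> carrier A \<Longrightarrow> x [^]\<^bsub>A\<^esub> p = \<one>\<^bsub>A\<^esub>"
    and card: "card (carrier A) = p ^ m"
  shows "card {W. subgroup W A \<and> card W = p ^ k} \<le> gaussian_coeff p (int m) (int k)"
proof -
  define K where "K = residue_ring (int p)"
  have p1: "1 < p" using p by (rule prime_gt_1_nat)
  have cV [simp]: "carrier (Fp_space A) = carrier A" by (simp add: Fp_space_def)
  interpret V: vectorspace K "Fp_space A"
    unfolding K_def by (rule Fp_space_vectorspace[OF p A exp])
  have rK: "ring K" by (rule V.R.ring_axioms)
  have fin: "finite (carrier A)" by (rule card_ge_0_finite) (use card p1 in simp)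
  have "card (carrier A) = p ^ V.dim"
    using V.card_eq_power_dim fin by (simp add: K_def card_carrier_residue_ring)
  then have "V.dim = m" using card power_inject_exp[OF p1] by simp
  then obtain T where lin: "linear_map K (V.func_space {..<m}) (Fp_space A) T"
    and bij: "bij_betw T (carrier (V.func_space {..<m})) (carrier A)"
    using V.ex_linear_iso_func_space[of m] fin by auto
  let ?F = "V.func_space {..<m}"
  let ?pre = "\<lambda>W. {f \<in> carrier ?F. T f \<in> W}"
  have image_pre: "T ` ?pre W = W" if "W \<subseteq> carrier A" for W
  proof
    show "T ` ?pre W \<subseteq> W" by auto
    show "W \<subseteq> T ` ?pre W"
    proof
      fix w assume w: "w \<in> W"
      then have "w \<in> T ` carrier ?F"
        using that unfolding bij_betw_imp_surj_on[OF bij] by (rule subsetD[rotated])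
      then obtain f where "f \<in> carrier ?F" "T f = w" by (rule imageE) simp
      with w show "w \<in> T ` ?pre W" by blast
    qed
  qed
  have fin': "finite {W. subspace K W ?F \<and> card W = p ^ k}"
  proof (rule finite_subset)
    show "{W. subspace K W ?F \<and> card W = p ^ k} \<subseteq> Pow (carrier ?F)"
      using subspace_carrier_subset by blast
    show "finite (Pow (carrier ?F))"
      using bij fin by (simp add: bij_betw_finite)
  qed
  have "card {W. subgroup W A \<and> card W = p ^ k} \<le> card {W. subspace K W ?F \<and> card W = p ^ k}"
  proof (rule card_inj_on_le[OF _ _ fin'])
    show "inj_on ?pre {W. subgroup W A \<and> card W = p ^ k}"
    proof (rule inj_onI)
      fix W W' assume "W \<in> {W. subgroup W A \<and> card W = p ^ k}" "W' \<in> {W. subgroup W A \<and> card W = p ^ k}"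
        and eq: "?pre W = ?pre W'"
      then have "W \<subseteq> carrier A" "W' \<subseteq> carrier A" by (auto dest: subgroup.subset)
      then have "W = T ` ?pre W" "W' = T ` ?pre W'" by (simp_all only: image_pre)
      with eq show "W = W'" by (simp only:)
    qed
    show "?pre ` {W. subgroup W A \<and> card W = p ^ k} \<subseteq> {W. subspace K W ?F \<and> card W = p ^ k}"
    proof clarify
      fix W assume W: "subgroup W A" and cW: "card W = p ^ k"
      have "subspace K (?pre W) ?F"
        by (rule linear_map.subspace_vimage[OF lin], unfold K_def, rule subspace_Fp_space[OF p A exp W])
      moreover have "card (?pre W) = card (T ` ?pre W)"
        by (rule card_image[symmetric], rule inj_on_subset[OF bij_betw_imp_inj_on[OF bij]]) blast
      ultimately show "subspace K (?pre W) ?F \<and> card (?pre W) = p ^ k"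
        using image_pre[OF subgroup.subset[OF W]] cW by simp
    qed
  qed
  then show ?thesis by (simp add: gaussian_coeff_eq_card[OF p] K_def)
qed

text \<open>The subspaces \<open>\<F>\<^sub>p \<oplus> W\<close> of \<open>\<F>\<^sub>p\<^sup>m\<^sup>+\<^sup>1\<close>, with \<open>W\<close> a \<open>k\<close>-dimensional subspace of \<open>\<F>\<^sub>p\<^sup>m\<close>, are distinct.\<close>

lemma gaussian_coeff_mono_Suc:
  assumes p: "Factorial_Ring.prime p"
  shows "gaussian_coeff p (int m) (int k) \<le> gaussian_coeff p (int (Suc m)) (int (Suc k))"
proof -
  define K where "K = residue_ring (int p)"
  interpret R: residues_prime p "residue_ring (int p)"
    by unfold_locales (use p in auto)
  interpret K: cring K unfolding K_def by (rule R.cring)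
  have fK: "field K" unfolding K_def by (rule R.is_field)
  have card_K: "card (carrier K) = p" unfolding K_def by (rule card_carrier_residue_ring)
  have finK: "finite (carrier K)" unfolding K_def by (simp add: residue_ring_def)
  let ?F = "\<lambda>n. K.func_space {..<n}"
  let ?ext = "\<lambda>(y, f :: nat \<Rightarrow> int). f(m := y)"
  let ?S = "\<lambda>n j. {W. subspace K W (?F n) \<and> card W = p ^ j}"
  have cF: "carrier (?F n) = {..<n} \<rightarrow>\<^sub>E carrier K" for n by (simp add: K.func_space_def)
  have inj: "inj_on ?ext (carrier K \<times> carrier (?F m))"
    unfolding cF by (rule inj_combinator) simp
  have WF: "W \<subseteq> carrier (?F m)" if "W \<in> ?S m k" for W
    using that by (auto dest: subspace_carrier_subset)
  have fin: "finite (?S (Suc m) (Suc k))"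
  proof (rule finite_subset)
    show "?S (Suc m) (Suc k) \<subseteq> Pow (carrier (?F (Suc m)))"
      using subspace_carrier_subset by blast
    show "finite (Pow (carrier (?F (Suc m))))"
      using finK by (simp add: cF finite_PiE)
  qed
  have "card (?S m k) \<le> card (?S (Suc m) (Suc k))"
  proof (rule card_inj_on_le[OF _ _ fin])
    show "inj_on (\<lambda>W. ?ext ` (carrier K \<times> W)) (?S m k)"
    proof (rule inj_onI)
      fix W W' assume W: "W \<in> ?S m k" and W': "W' \<in> ?S m k"
        and eq: "?ext ` (carrier K \<times> W) = ?ext ` (carrier K \<times> W')"
      have "carrier K \<times> W \<subseteq> carrier K \<times> carrier (?F m)"
        and "carrier K \<times> W' \<subseteq> carrier K \<times> carrier (?F m)"
        using WF[OF W] WF[OF W'] by auto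
      then have "carrier K \<times> W = carrier K \<times> W'"
        by (rule inj_on_image_eq_iff[OF inj, THEN iffD1, OF _ _ eq])
      then show "W = W'" using K.zero_closed by auto
    qed
    show "(\<lambda>W. ?ext ` (carrier K \<times> W)) ` ?S m k \<subseteq> ?S (Suc m) (Suc k)"
    proof clarify
      fix W assume W: "subspace K W (?F m)" and cW: "card W = p ^ k"
      have WF: "W \<subseteq> carrier (?F m)" by (rule subspace_carrier_subset[OF W])
      interpret W: submodule K W "?F m" using W by (simp add: subspace_def)
      let ?W = "?ext ` (carrier K \<times> W)"
      have "card ?W = card (carrier K \<times> W)"
        by (rule card_image, rule inj_on_subset[OF inj]) (use WF in auto)
      then have card: "card ?W = p ^ Suc k"
        by (simp add: card_cartesian_product card_K cW)
      have add: "g(m := y) \<oplus>\<^bsub>?F (Suc m)\<^esub> h(m := z) = (g \<oplus>\<^bsub>?F m\<^esub> h)(m := y \<oplus>\<^bsub>K\<^esub> z)"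
        and smult: "c \<odot>\<^bsub>?F (Suc m)\<^esub> g(m := y) = (c \<odot>\<^bsub>?F m\<^esub> g)(m := c \<otimes>\<^bsub>K\<^esub> y)"
        for c g h y z
        by (auto simp: K.func_space_def fun_eq_iff)
      have zero: "\<zero>\<^bsub>?F (Suc m)\<^esub> = (\<zero>\<^bsub>?F m\<^esub>)(m := \<zero>\<^bsub>K\<^esub>)"
        by (auto simp: K.func_space_def fun_eq_iff)
      have mem: "g(m := y) \<in> ?W" if "g \<in> W" "y \<in> carrier K" for g y
        using that by force
      have "Module.module K (?F (Suc m))" by (rule K.func_space_is_module)
      moreover have "?W \<subseteq> carrier (?F (Suc m))"
      proof -
        have "carrier (?F (Suc m)) = ?ext ` (carrier K \<times> carrier (?F m))"
          unfolding cF by (simp only: lessThan_Suc PiE_insert_eq)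
        then show ?thesis using WF by (simp only:) (intro image_mono Sigma_mono; simp)
      qed
      ultimately have "submodule K ?W (?F (Suc m))"
      proof (rule submodule.intro)
        show "\<zero>\<^bsub>?F (Suc m)\<^esub> \<in> ?W" unfolding zero by (intro mem) simp_all
      next
        fix f f' assume "f \<in> ?W" "f' \<in> ?W"
        then obtain g y g' y' where "f = g(m := y)" "f' = g'(m := y')"
          and "g \<in> W" "g' \<in> W" "y \<in> carrier K" "y' \<in> carrier K"
          by auto
        then show "f \<oplus>\<^bsub>?F (Suc m)\<^esub> f' \<in> ?W" by (simp only: add) (intro mem; simp)
      next
        fix c f assume "c \<in> carrier K" "f \<in> ?W"
        moreover from this obtain g y where "f = g(m := y)" "g \<in> W" "y \<in> carrier K"
          by auto
        ultimately show "c \<odot>\<^bsub>?F (Suc m)\<^esub> f \<in> ?W" by (simp only: smult) (intro mem; simp)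
      qed
      then have "subspace K ?W (?F (Suc m))"
        by (intro VectorSpace.subspace.intro vectorspace.intro K.func_space_is_module fK)
      with card show "subspace K ?W (?F (Suc m)) \<and> card ?W = p ^ Suc k" by blast
    qed
  qed
  then show ?thesis
    unfolding gaussian_coeff_eq_card[OF p] K_def[symmetric] .
qed

text \<open>This absorbs the slack between a lower bound \<open>w\<close> on the dimension of a subspace and its exact
  dimension: the number of \<open>u\<close>-dimensional spaces that contain a fixed subspace does not decrease when
  the subspace shrinks.\<close>

lemma gaussian_coeff_mono_add:
  assumes p: "Factorial_Ring.prime p" and j: "0 \<le> j"
  shows "gaussian_coeff p m k \<le> gaussian_coeff p (m + j) (k + j)"
proof (cases "0 \<le> k \<and> k \<le> m")
  case False
  then show ?thesis by (auto simp: gaussian_coeff_def)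
next
  case True
  have "gaussian_coeff p (int a) (int b) \<le> gaussian_coeff p (int (a + c)) (int (b + c))" for a b c
  proof (induction c)
    case (Suc c)
    then show ?case using gaussian_coeff_mono_Suc[OF p, of "a + c" "b + c"] by simp
  qed simp
  from this[of "nat m" "nat k" "nat j"] show ?thesis using True j by simp
qed

section \<open>Central sections of exponent \<open>p\<close>\<close>

text \<open>\<open>A/M\<close> is a section of exponent dividing \<open>p\<close> that is central in \<open>G/M\<close>. Normality of \<open>A\<close> and \<open>M\<close> follows from
  these conditions, because \<open>x a x\<^sup>-\<^sup>1\<close> and \<open>a\<close> differ by an element of \<open>M\<close>.\<close>

definition p_central :: "('a, 'b) monoid_scheme \<Rightarrow> nat \<Rightarrow> 'a set \<Rightarrow> 'a set \<Rightarrow> bool" where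
  "p_central G p A M \<longleftrightarrow>
    subgroup A G \<and> subgroup M G \<and> M \<subseteq> A \<and> (\<forall>a\<in>A. a [^]\<^bsub>G\<^esub> p \<in> M) \<and>
    (\<forall>a\<in>A. \<forall>x\<in>carrier G. a \<otimes>\<^bsub>G\<^esub> x \<otimes>\<^bsub>G\<^esub> inv\<^bsub>G\<^esub> a \<otimes>\<^bsub>G\<^esub> inv\<^bsub>G\<^esub> x \<in> M)"

context group
begin

lemma p_central_lower: "p_central G p A M \<Longrightarrow> subgroup B G \<Longrightarrow> M \<subseteq> B \<Longrightarrow> B \<subseteq> A \<Longrightarrow> p_central G p B M"
  unfolding p_central_def by blast

lemma p_central_upper: "p_central G p A M \<Longrightarrow> subgroup B G \<Longrightarrow> M \<subseteq> B \<Longrightarrow> B \<subseteq> A \<Longrightarrow> p_central G p A B"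
  unfolding p_central_def by blast

lemma p_central_conj:
  assumes "p_central G p A M" "a \<in> A" "x \<in> carrier G"
  shows "x \<otimes> a \<otimes> inv x \<otimes> inv a \<in> M"
proof -
  have "subgroup M G" and a: "a \<in> carrier G"
    using assms by (auto simp: p_central_def dest: subgroup.subset)
  moreover have "inv (a \<otimes> x \<otimes> inv a \<otimes> inv x) = x \<otimes> a \<otimes> inv x \<otimes> inv a"
    using a assms(3) by (simp add: inv_mult_group m_assoc)
  ultimately show ?thesis
    using assms by (metis p_central_def subgroup.m_inv_closed)
qed

lemma p_central_normal:
  assumes "p_central G p A M"
  shows "A \<lhd> G" and "M \<lhd> G"
proof -
  have A: "subgroup A G" and M: "subgroup M G" and MA: "M \<subseteq> A"
    using assms by (auto simp: p_central_def)
  have eq: "x \<otimes> a \<otimes> inv x = (x \<otimes> a \<otimes> inv x \<otimes> inv a) \<otimes> a" if "a \<in> A" "x \<in> carrier G" for a x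
    using that subgroup.mem_carrier[OF A] by (simp add: m_assoc)
  have "x \<otimes> a \<otimes> inv x \<in> A" if "a \<in> A" "x \<in> carrier G" for a x
    using p_central_conj[OF assms that] that MA
    by (subst eq[OF that]) (auto intro: subgroup.m_closed[OF A])
  then show "A \<lhd> G" using A by (simp add: normal_inv_iff)
  have "x \<otimes> a \<otimes> inv x \<in> M" if "a \<in> M" "x \<in> carrier G" for a x
  proof -
    have "a \<in> A" using that MA by blast
    then show ?thesis
      using p_central_conj[OF assms _ that(2)] that
      by (subst eq) (auto intro: subgroup.m_closed[OF M])
  qed
  then show "M \<lhd> G" using M by (simp add: normal_inv_iff)
qed

lemma p_central_quotient:
  assumes "p_central G p A M"
  shows "comm_group (G\<lparr>carrier := A\<rparr> Mod M)"
    and "\<And>X. X \<in> carrier (G\<lparr>carrier := A\<rparr> Mod M) \<Longrightarrow>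
           X [^]\<^bsub>G\<lparr>carrier := A\<rparr> Mod M\<^esub> p = \<one>\<^bsub>G\<lparr>carrier := A\<rparr> Mod M\<^esub>"
proof -
  let ?A = "G\<lparr>carrier := A\<rparr>"
  have A: "subgroup A G" and M: "subgroup M G" and MA: "M \<subseteq> A"
    using assms by (auto simp: p_central_def)
  interpret M: normal M G by (rule p_central_normal[OF assms])
  interpret N: normal M ?A
    by (rule normal_restrict_supergroup[OF A M.normal_axioms MA])
  have coset: "M #>\<^bsub>?A\<^esub> a = M #> a" for a by (simp add: r_coset_def)
  have carr: "carrier (?A Mod M) = (\<lambda>a. M #> a) ` A"
    by (simp add: carrier_FactGroup coset)
  have coset_eqI: "M #> a = M #> b" if "a \<in> A" "b \<in> A" "a \<otimes> inv b \<in> M" for a b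
  proof -
    have "a \<in> carrier G" "b \<in> carrier G" using that subgroup.mem_carrier[OF A] by auto
    then have "a \<in> M #> b" using M.rcos_module_rev[OF is_group] that by blast
    then show ?thesis using repr_independence[OF _ _ M] \<open>b \<in> carrier G\<close> by metis
  qed
  show "comm_group (?A Mod M)"
  proof (rule group.group_comm_groupI[OF N.factorgroup_is_group])
    fix X Y assume "X \<in> carrier (?A Mod M)" "Y \<in> carrier (?A Mod M)"
    then obtain a b where ab: "a \<in> A" "b \<in> A" and XY: "X = M #> a" "Y = M #> b"
      by (auto simp: carr)
    then have abG: "a \<in> carrier G" "b \<in> carrier G" using subgroup.mem_carrier[OF A] by auto
    have "a \<otimes> b \<otimes> inv (b \<otimes> a) = a \<otimes> b \<otimes> inv a \<otimes> inv b"
      using abG by (simp add: inv_mult_group m_assoc)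
    then have "M #> (a \<otimes> b) = M #> (b \<otimes> a)"
      using assms ab abG subgroup.m_closed[OF A] by (intro coset_eqI) (auto simp: p_central_def)
    then show "X \<otimes>\<^bsub>?A Mod M\<^esub> Y = Y \<otimes>\<^bsub>?A Mod M\<^esub> X"
      using XY abG by (simp add: M.rcos_sum)
  qed
  fix X assume "X \<in> carrier (?A Mod M)"
  then obtain a where a: "a \<in> A" and X: "X = M #>\<^bsub>?A\<^esub> a" by (auto simp: carr coset)
  have "X [^]\<^bsub>?A Mod M\<^esub> p = M #>\<^bsub>?A\<^esub> (a [^]\<^bsub>?A\<^esub> p)"
    unfolding X using a by (intro N.FactGroup_pow) simp
  also have "\<dots> = M #> (a [^] p)" by (simp add: coset nat_pow_consistent[symmetric])
  also have "\<dots> = M"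
    using assms a by (intro M.rcos_const[OF is_group]) (simp add: p_central_def)
  finally show "X [^]\<^bsub>?A Mod M\<^esub> p = \<one>\<^bsub>?A Mod M\<^esub>" by simp
qed

lemma card_subgroup_quotient:
  assumes A: "subgroup A G" and M: "subgroup M G" and "M \<subseteq> A"
  shows "card A = card (rcosets\<^bsub>G\<lparr>carrier := A\<rparr>\<^esub> M) * card M"
proof -
  have "group (G\<lparr>carrier := A\<rparr>)" by (rule subgroup.subgroup_is_group[OF A is_group])
  moreover have "subgroup M (G\<lparr>carrier := A\<rparr>)" by (rule subgroup_incl[OF M A assms(3)])
  ultimately show ?thesis
    using group.lagrange by (fastforce simp: order_def)
qed

lemma card_p_central:
  assumes p: "Factorial_Ring.prime p" and fin: "finite (carrier G)" and AM: "p_central G p A M"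
  shows "card A = p ^ section_dim G p A M * card M"
proof -
  let ?Q = "G\<lparr>carrier := A\<rparr> Mod M"
  have A: "subgroup A G" and M: "subgroup M G" and MA: "M \<subseteq> A"
    using AM by (auto simp: p_central_def)
  have finQ: "finite (carrier (Fp_space ?Q))"
    using finite_subset[OF subgroup.subset[OF A] fin]
    by (simp add: Fp_space_def carrier_FactGroup)
  have "card (carrier (Fp_space ?Q)) = p ^ section_dim G p A M"
    using vectorspace.card_eq_power_dim[OF Fp_space_vectorspace[OF p p_central_quotient[OF AM]] finQ]
    by (simp add: section_dim_def card_carrier_residue_ring)
  then have "card (rcosets\<^bsub>G\<lparr>carrier := A\<rparr>\<^esub> M) = p ^ section_dim G p A M"
    by (simp add: Fp_space_def FactGroup_def)
  then show ?thesis using card_subgroup_quotient[OF A M MA] by simp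
qed

text \<open>The subgroups between \<open>M\<close> and \<open>A\<close> correspond to the subgroups of \<open>A/M\<close>, which is an elementary
  abelian group.\<close>

lemma card_intermediate_subgroups_le_gaussian_coeff:
  assumes p: "Factorial_Ring.prime p" and fin: "finite (carrier G)" and AM: "p_central G p A M"
    and card: "card A = p ^ m * card M"
  shows "card {B. subgroup B G \<and> M \<subseteq> B \<and> B \<subseteq> A \<and> card B = p ^ k * card M}
    \<le> gaussian_coeff p (int m) (int k)"
proof -
  let ?Q = "G\<lparr>carrier := A\<rparr> Mod M"
  let ?S = "{B. subgroup B G \<and> M \<subseteq> B \<and> B \<subseteq> A \<and> card B = p ^ k * card M}"
  let ?T = "{W. subgroup W ?Q \<and> card W = p ^ k}"
  let ?cosets = "\<lambda>B. rcosets\<^bsub>G\<lparr>carrier := B\<rparr>\<^esub> M"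
  have A: "subgroup A G" and M: "subgroup M G" and MA: "M \<subseteq> A"
    using AM by (auto simp: p_central_def)
  have M0: "card M > 0" using subgroup.finite_imp_card_positive[OF M fin] .
  have finA: "finite A" by (rule finite_subset[OF subgroup.subset[OF A] fin])
  have Q: "comm_group ?Q" by (rule p_central_quotient[OF AM])
  have cQ: "carrier ?Q = ?cosets A" by (simp add: FactGroup_def)
  have finQ: "finite (carrier ?Q)" using finA by (simp add: carrier_FactGroup)
  have "card (carrier ?Q) = p ^ m"
    using card_subgroup_quotient[OF A M MA] card M0 cQ by simp
  then have le: "card ?T \<le> gaussian_coeff p (int m) (int k)"
    by (intro card_subgroups_le_gaussian_coeff[OF p Q] p_central_quotient(2)[OF AM])
  have "card ?S \<le> card ?T"
  proof (rule card_inj_on_le)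
    show "finite ?T"
      by (rule finite_subset[of _ "Pow (carrier ?Q)"]) (use finQ subgroup.subset in auto)
    have "\<Union> (?cosets B) = B" if "B \<in> ?S" for B
    proof -
      have B: "subgroup B G" "M \<subseteq> B" using that by auto
      then have "subgroup M (G\<lparr>carrier := B\<rparr>)" by (intro subgroup_incl[OF M])
      then show ?thesis
        using group.rcosets_part_G[OF subgroup.subgroup_is_group[OF B(1) is_group]] by fastforce
    qed
    then show "inj_on ?cosets ?S" by (rule inj_on_inverseI)
    show "?cosets ` ?S \<subseteq> ?T"
    proof clarify
      fix B assume B: "subgroup B G" and MB: "M \<subseteq> B" and BA: "B \<subseteq> A"
        and cB: "card B = p ^ k * card M"
      have "M \<lhd> G\<lparr>carrier := B\<rparr>"
        by (rule normal_restrict_supergroup[OF B p_central_normal(2)[OF AM] MB])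
      then have "group (G\<lparr>carrier := B\<rparr> Mod M)" by (rule normal.factorgroup_is_group)
      also have "G\<lparr>carrier := B\<rparr> Mod M = ?Q\<lparr>carrier := ?cosets B\<rparr>"
        by (simp add: FactGroup_def set_mult_def[abs_def])
      finally have "group (?Q\<lparr>carrier := ?cosets B\<rparr>)" .
      moreover have "?cosets B \<subseteq> carrier ?Q"
        using BA by (auto simp: cQ RCOSETS_def r_coset_def)
      ultimately have "subgroup (?cosets B) ?Q"
        using group.group_incl_imp_subgroup comm_group.axioms(2)[OF Q] by blast
      moreover have "card (?cosets B) = p ^ k"
        using card_subgroup_quotient[OF B M MB] cB M0 by simp
      ultimately show "subgroup (?cosets B) ?Q \<and> card (?cosets B) = p ^ k" ..
    qed
  qed
  with le show ?thesis by simp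
qed

end

section \<open>Products of subgroups\<close>

context group
begin

lemma subgroup_set_mult_normal: "subgroup H G \<Longrightarrow> N \<lhd> G \<Longrightarrow> subgroup (H <#> N) G"
  using second_isomorphism_grp.normal_set_mult_subgroup[of N G H] commut_normal[of H N]
  by (simp add: second_isomorphism_grp_def second_isomorphism_grp_axioms_def)

lemma set_mult_upper1:
  assumes "subgroup H G" "subgroup N G"
  shows "H \<subseteq> H <#> N"
proof
  fix h assume "h \<in> H"
  moreover from this have "h = h \<otimes> \<one>" using subgroup.mem_carrier[OF assms(1)] by simp
  ultimately show "h \<in> H <#> N"
    using subgroup.one_closed[OF assms(2)] unfolding set_mult_def by blast
qed

lemma set_mult_upper2:
  assumes "subgroup H G" "subgroup N G"
  shows "N \<subseteq> H <#> N"
proof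
  fix h assume "h \<in> N"
  moreover from this have "h = \<one> \<otimes> h" using subgroup.mem_carrier[OF assms(2)] by simp
  ultimately show "h \<in> H <#> N"
    using subgroup.one_closed[OF assms(1)] unfolding set_mult_def by blast
qed

lemma set_mult_least: "subgroup K G \<Longrightarrow> H \<subseteq> K \<Longrightarrow> N \<subseteq> K \<Longrightarrow> H <#> N \<subseteq> K"
  unfolding set_mult_def using subgroup.m_closed by fastforce

lemma set_mult_absorb:
  assumes "subgroup H G" "N' \<lhd> G" "N \<lhd> G" "N' \<subseteq> N"
  shows "(H <#> N') <#> N = H <#> N"
proof -
  have sub: "subgroup N' G" "subgroup N G" using assms by (auto intro: normal_imp_subgroup)
  show ?thesis
  proof
    have "H <#> N' \<subseteq> H <#> N" by (rule mono_set_mult[OF order_refl assms(4)])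
    then show "(H <#> N') <#> N \<subseteq> H <#> N"
      using set_mult_upper2[OF assms(1) sub(2)]
      by (rule set_mult_least[OF subgroup_set_mult_normal[OF assms(1,3)]])
    show "H <#> N \<subseteq> (H <#> N') <#> N"
      by (rule mono_set_mult[OF set_mult_upper1[OF assms(1) sub(1)] order_refl])
  qed
qed

text \<open>Dedekind's modular law. It turns \<open>(H \<inter> G\<^sub>i)G\<^sub>i\<^sub>+\<^sub>1\<close>, whose dimension over \<open>G\<^sub>i\<^sub>+\<^sub>1\<close> is a layer dimension,
  into \<open>HG\<^sub>i\<^sub>+\<^sub>1 \<inter> G\<^sub>i\<close>.\<close>

lemma modular_law:
  assumes H: "subgroup H G" and A: "subgroup A G" and N: "subgroup N G" and "N \<subseteq> A"
  shows "(H \<inter> A) <#> N = (H <#> N) \<inter> A"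
proof
  show "(H \<inter> A) <#> N \<subseteq> (H <#> N) \<inter> A"
    using set_mult_least[OF A, of "H \<inter> A" N] assms(4) mono_set_mult[of "H \<inter> A" H N N G] by blast
  show "(H <#> N) \<inter> A \<subseteq> (H \<inter> A) <#> N"
  proof
    fix x assume x: "x \<in> (H <#> N) \<inter> A"
    then obtain h n where hn: "h \<in> H" "n \<in> N" "x = h \<otimes> n" by (auto simp: set_mult_def)
    then have "h \<in> carrier G" "n \<in> carrier G"
      using subgroup.mem_carrier[OF H] subgroup.mem_carrier[OF N] by auto
    then have "h = x \<otimes> inv n" using hn by (simp add: m_assoc)
    also have "\<dots> \<in> A"
      using x hn assms(4) subgroup.m_closed[OF A] subgroup.m_inv_closed[OF A] by blast
    finally show "x \<in> (H \<inter> A) <#> N" using hn by (auto simp: set_mult_def)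
  qed
qed

text \<open>The second isomorphism theorem, in terms of orders.\<close>

lemma card_set_mult_normal:
  assumes H: "subgroup H G" and N: "N \<lhd> G"
  shows "card (H <#> N) * card (H \<inter> N) = card H * card N"
proof -
  interpret second_isomorphism_grp N G H
    using H N by (simp add: second_isomorphism_grp_def second_isomorphism_grp_axioms_def)
  have "card (rcosets\<^bsub>G\<lparr>carrier := H\<rparr>\<^esub> (N \<inter> H)) = card (rcosets\<^bsub>G\<lparr>carrier := N <#> H\<rparr>\<^esub> N)"
    using normal_intersection_quotient_isom
    by (auto simp: iso_def FactGroup_def bij_betw_same_card)
  moreover have "card H = card (rcosets\<^bsub>G\<lparr>carrier := H\<rparr>\<^esub> (N \<inter> H)) * card (N \<inter> H)"
    using card_subgroup_quotient[OF H] subgroups_Inter_pair[OF is_subgroup H] by blast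
  moreover have "card (N <#> H) = card (rcosets\<^bsub>G\<lparr>carrier := N <#> H\<rparr>\<^esub> N) * card N"
    using card_subgroup_quotient[OF normal_set_mult_subgroup is_subgroup] H_contained_in_set_mult
    by blast
  ultimately show ?thesis
    using commut_normal[OF H N] by (simp add: Int_commute)
qed

end

section \<open>The lower \<open>p\<close>-series\<close>

context group
begin

lemma conj_pow:
  assumes "g \<in> carrier G" "h \<in> carrier G"
  shows "g \<otimes> h [^] (n::nat) \<otimes> inv g = (g \<otimes> h \<otimes> inv g) [^] n"
proof (induction n)
  case (Suc n)
  have "g \<otimes> h [^] Suc n \<otimes> inv g = (g \<otimes> h [^] n \<otimes> inv g) \<otimes> (g \<otimes> h \<otimes> inv g)"
    using assms by (simp add: m_assoc inv_solve_left)
  then show ?case using Suc by simp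
qed (use assms in simp)

lemma conj_commutator:
  assumes "g \<in> carrier G" "h \<in> carrier G" "k \<in> carrier G"
  shows "g \<otimes> (h \<otimes> k \<otimes> inv h \<otimes> inv k) \<otimes> inv g =
    (g \<otimes> h \<otimes> inv g) \<otimes> (g \<otimes> k \<otimes> inv g) \<otimes> inv (g \<otimes> h \<otimes> inv g) \<otimes> inv (g \<otimes> k \<otimes> inv g)"
proof -
  have cancel: "inv g \<otimes> (g \<otimes> x) = x" if "x \<in> carrier G" for x
    using that assms by (simp add: m_assoc[symmetric])
  show ?thesis using assms by (simp add: m_assoc inv_mult_group cancel)
qed

lemma power_subgroup_normal:
  assumes "H \<lhd> G"
  shows "power_subgroup G p H \<lhd> G"
proof -
  interpret H: normal H G by (rule assms)
  show ?thesis
    unfolding power_subgroup_def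
  proof (rule normal_generateI)
    fix x g assume "x \<in> (\<lambda>x. x [^] p) ` H" and g: "g \<in> carrier G"
    then obtain h where h: "h \<in> H" and x: "x = h [^] p" by blast
    have "g \<otimes> x \<otimes> inv g = (g \<otimes> h \<otimes> inv g) [^] p"
      unfolding x by (rule conj_pow[OF g H.mem_carrier[OF h]])
    then show "g \<otimes> x \<otimes> inv g \<in> (\<lambda>x. x [^] p) ` H"
      using H.inv_op_closed2[OF g h] by blast
  qed auto
qed

lemma commutator_subgroup_normal:
  assumes "H \<lhd> G" "K \<lhd> G"
  shows "commutator_subgroup G H K \<lhd> G"
proof -
  interpret H: normal H G by (rule assms)
  interpret K: normal K G by (rule assms)
  show ?thesis
    unfolding commutator_subgroup_def
  proof (rule normal_generateI)
    fix x g assume "x \<in> (\<Union>h\<in>H. \<Union>k\<in>K. {h \<otimes> k \<otimes> inv h \<otimes> inv k})" and g: "g \<in> carrier G"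
    then obtain h k where hk: "h \<in> H" "k \<in> K" and x: "x = h \<otimes> k \<otimes> inv h \<otimes> inv k" by blast
    have "g \<otimes> x \<otimes> inv g = (g \<otimes> h \<otimes> inv g) \<otimes> (g \<otimes> k \<otimes> inv g) \<otimes>
        inv (g \<otimes> h \<otimes> inv g) \<otimes> inv (g \<otimes> k \<otimes> inv g)"
      unfolding x by (rule conj_commutator[OF g H.mem_carrier[OF hk(1)] K.mem_carrier[OF hk(2)]])
    then show "g \<otimes> x \<otimes> inv g \<in> (\<Union>h\<in>H. \<Union>k\<in>K. {h \<otimes> k \<otimes> inv h \<otimes> inv k})"
      using H.inv_op_closed2[OF g hk(1)] K.inv_op_closed2[OF g hk(2)] by blast
  qed auto
qed

lemma power_commutator_normal:
  "H \<lhd> G \<Longrightarrow> K \<lhd> G \<Longrightarrow> power_commutator G p H K \<lhd> G"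
  unfolding power_commutator_def
  by (intro normal_subgroup_set_mult_closed power_subgroup_normal commutator_subgroup_normal)

lemma power_commutator_least:
  assumes "subgroup N G" and "\<And>h. h \<in> H \<Longrightarrow> h [^] p \<in> N"
    and "\<And>h k. h \<in> H \<Longrightarrow> k \<in> K \<Longrightarrow> h \<otimes> k \<otimes> inv h \<otimes> inv k \<in> N"
  shows "power_commutator G p H K \<subseteq> N"
  unfolding power_commutator_def power_subgroup_def commutator_subgroup_def
  using assms by (intro set_mult_least generate_subgroup_incl) auto

lemma power_in_power_commutator:
  assumes "H \<lhd> G" "K \<lhd> G" "h \<in> H"
  shows "h [^] p \<in> power_commutator G p H K"
proof -
  have "h [^] p \<in> power_subgroup G p H"
    using assms(3) by (auto simp: power_subgroup_def intro: generate.incl)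
  then show ?thesis
    unfolding power_commutator_def
    using set_mult_upper1 power_subgroup_normal[OF assms(1)]
      commutator_subgroup_normal[OF assms(1,2)] normal_imp_subgroup by blast
qed

lemma commutator_in_power_commutator:
  assumes "H \<lhd> G" "K \<lhd> G" "h \<in> H" "k \<in> K"
  shows "h \<otimes> k \<otimes> inv h \<otimes> inv k \<in> power_commutator G p H K"
proof -
  have "h \<otimes> k \<otimes> inv h \<otimes> inv k \<in> commutator_subgroup G H K"
    using assms(3,4) by (auto simp: commutator_subgroup_def intro!: generate.incl)
  then show ?thesis
    unfolding power_commutator_def
    using set_mult_upper2 power_subgroup_normal[OF assms(1)]
      commutator_subgroup_normal[OF assms(1,2)] normal_imp_subgroup by blast
qed

lemma power_commutator_mono:
  "H \<subseteq> H' \<Longrightarrow> K \<subseteq> K' \<Longrightarrow> power_commutator G p H K \<subseteq> power_commutator G p H' K'"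
  unfolding power_commutator_def power_subgroup_def commutator_subgroup_def
  by (intro mono_set_mult mono_generate) blast+

lemma lower_p_series_Suc:
  "1 \<le> i \<Longrightarrow> lower_p_series G p (Suc i) = power_commutator G p (lower_p_series G p i) (carrier G)"
  by (cases i) auto

lemma lower_p_series_normal: "lower_p_series G p i \<lhd> G"
proof (induction i)
  case 0
  then show ?case by (simp add: normal_self)
next
  case (Suc i)
  then show ?case
    by (cases i) (auto simp: normal_self intro: power_commutator_normal)
qed

lemma p_central_lower_p_series:
  assumes "1 \<le> i"
  shows "p_central G p (lower_p_series G p i) (lower_p_series G p (Suc i))"
proof -
  let ?H = "lower_p_series G p i"
  have H: "?H \<lhd> G" by (rule lower_p_series_normal)
  interpret H: normal ?H G by (rule H)
  have "power_commutator G p ?H (carrier G) \<subseteq> ?H"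
  proof (rule power_commutator_least[OF H.is_subgroup])
    fix h assume h: "h \<in> ?H"
    show "h [^] p \<in> ?H" using h subgroup_int_pow_closed[OF H.is_subgroup h, of "int p"]
      by (simp add: int_pow_int)
    fix k assume k: "k \<in> carrier G"
    have "h \<otimes> k \<otimes> inv h \<otimes> inv k = h \<otimes> (k \<otimes> inv h \<otimes> inv k)"
      using h k by (simp add: m_assoc)
    then show "h \<otimes> k \<otimes> inv h \<otimes> inv k \<in> ?H"
      using h k H.inv_op_closed2 by simp
  qed
  then show ?thesis
    unfolding p_central_def lower_p_series_Suc[OF assms]
    using power_commutator_normal[OF H normal_self] H normal_imp_subgroup
      power_in_power_commutator[OF H normal_self] commutator_in_power_commutator[OF H normal_self]
    by blast
qed

lemma lower_p_series_2_restrict: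
  assumes U: "subgroup U G"
  shows "lower_p_series (G\<lparr>carrier := U\<rparr>) p 2 = power_commutator G p U U"
proof -
  let ?U = "G\<lparr>carrier := U\<rparr>"
  have "(\<lambda>x. x [^]\<^bsub>?U\<^esub> p) ` U \<subseteq> U"
    using subgroup_int_pow_closed[OF U, of _ "int p"]
    by (auto simp: int_pow_int nat_pow_consistent[symmetric])
  then have 1: "power_subgroup ?U p U = power_subgroup G p U"
    unfolding power_subgroup_def
    by (subst generate_consistent[OF _ U]) (simp_all add: nat_pow_consistent[symmetric])
  have "(\<Union>h\<in>U. \<Union>k\<in>U. {h \<otimes>\<^bsub>?U\<^esub> k \<otimes>\<^bsub>?U\<^esub> inv\<^bsub>?U\<^esub> h \<otimes>\<^bsub>?U\<^esub> inv\<^bsub>?U\<^esub> k}) =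
        (\<Union>h\<in>U. \<Union>k\<in>U. {h \<otimes> k \<otimes> inv h \<otimes> inv k})"
    using U by simp
  moreover have "\<dots> \<subseteq> U"
    using subgroup.m_closed[OF U] subgroup.m_inv_closed[OF U] by auto
  ultimately have 2: "commutator_subgroup ?U U U = commutator_subgroup G U U"
    unfolding commutator_subgroup_def by (simp add: generate_consistent[OF _ U])
  show ?thesis
    by (simp add: numeral_2_eq_2 power_commutator_def 1 2)
qed

lemma layer_subgroup:
  assumes H: "subgroup H G" and i: "1 \<le> i"
  shows "p_central G p ((H <#> lower_p_series G p (Suc i)) \<inter> lower_p_series G p i) (lower_p_series G p (Suc i))"
    and "layer_dim G p H i = section_dim G p
      ((H <#> lower_p_series G p (Suc i)) \<inter> lower_p_series G p i) (lower_p_series G p (Suc i))"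
proof -
  let ?L = "lower_p_series G p"
  note c = p_central_lower_p_series[OF i, of p]
  have L: "subgroup (?L i) G" "subgroup (?L (Suc i)) G" "?L (Suc i) \<subseteq> ?L i"
    using c by (auto simp: p_central_def)
  have HL: "subgroup (H <#> ?L (Suc i)) G"
    by (rule subgroup_set_mult_normal[OF H lower_p_series_normal])
  show "p_central G p ((H <#> ?L (Suc i)) \<inter> ?L i) (?L (Suc i))"
    using set_mult_upper2[OF H L(2)] L(3)
    by (intro p_central_lower[OF c] subgroups_Inter_pair[OF HL L(1)]) auto
  show "layer_dim G p H i = section_dim G p ((H <#> ?L (Suc i)) \<inter> ?L i) (?L (Suc i))"
    unfolding layer_dim_def modular_law[OF H L(1,2,3), symmetric] by simp
qed

text \<open>Passing from \<open>HG\<^sub>i\<close> to \<open>HG\<^sub>i\<^sub>+\<^sub>1\<close> replaces the factor \<open>|G\<^sub>i|\<close> by \<open>|HG\<^sub>i\<^sub>+\<^sub>1 \<inter> G\<^sub>i|\<close>, which is a power of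
  \<open>p\<close> given by the layer dimension times \<open>|G\<^sub>i\<^sub>+\<^sub>1|\<close>. So the index of \<open>G\<^sub>i\<close> in \<open>HG\<^sub>i\<close> records the sum of the
  first \<open>i - 1\<close> layer dimensions.\<close>

lemma card_set_mult_lower_p_series:
  assumes p: "Factorial_Ring.prime p" and fin: "finite (carrier G)" and H: "subgroup H G"
    and i: "1 \<le> i"
  shows "card (H <#> lower_p_series G p i) =
    p ^ (\<Sum>j=1..<i. layer_dim G p H j) * card (lower_p_series G p i)"
  using i
proof (induction i rule: nat_induct_at_least)
  case base
  have "H <#> carrier G = carrier G"
    using set_mult_upper2[OF H subgroup_self] set_mult_least[OF subgroup_self subgroup.subset[OF H]]
    by blast
  then show ?case by simp
next
  case (Suc i)
  let ?L = "lower_p_series G p"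
  let ?K = "H <#> ?L (Suc i)"
  note c = p_central_lower_p_series[OF Suc.hyps, of p]
  have K: "subgroup ?K G" by (rule subgroup_set_mult_normal[OF H lower_p_series_normal])
  have pos: "card (?L i) > 0"
    using subgroup.finite_imp_card_positive[OF normal_imp_subgroup[OF lower_p_series_normal] fin] .
  have "?L (Suc i) \<subseteq> ?L i" using c by (simp add: p_central_def)
  then have "?K <#> ?L i = H <#> ?L i"
    by (intro set_mult_absorb[OF H] lower_p_series_normal)
  then have "card ?K * card (?L i) = card (H <#> ?L i) * card (?K \<inter> ?L i)"
    using card_set_mult_normal[OF K lower_p_series_normal, of p i] by simp
  also have "card (?K \<inter> ?L i) = p ^ layer_dim G p H i * card (?L (Suc i))"
    unfolding layer_subgroup(2)[OF H Suc.hyps]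
    by (rule card_p_central[OF p fin layer_subgroup(1)[OF H Suc.hyps]])
  also have "card (H <#> ?L i) = p ^ (\<Sum>j=1..<i. layer_dim G p H j) * card (?L i)"
    by (rule Suc.IH)
  finally show ?case
    using pos Suc.hyps by (simp add: power_add mult_ac)
qed

end

section \<open>Complements of a central section\<close>

context group
begin

lemma commutator_mult_central:
  assumes "x \<in> carrier G" "y \<in> carrier G" "z \<in> carrier G" "z' \<in> carrier G"
    and z: "\<And>g. g \<in> carrier G \<Longrightarrow> z \<otimes> g = g \<otimes> z" and z': "\<And>g. g \<in> carrier G \<Longrightarrow> z' \<otimes> g = g \<otimes> z'"
  shows "(x \<otimes> z) \<otimes> (y \<otimes> z') \<otimes> inv (x \<otimes> z) \<otimes> inv (y \<otimes> z') = x \<otimes> y \<otimes> inv x \<otimes> inv y"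
proof -
  have "(x \<otimes> z) \<otimes> (y \<otimes> z') = (x \<otimes> y) \<otimes> (z \<otimes> z')"
    using assms(1-4) z[of y] by (simp add: m_assoc[symmetric]) (simp add: m_assoc)
  moreover have "(y \<otimes> z') \<otimes> (x \<otimes> z) = (y \<otimes> x) \<otimes> (z \<otimes> z')"
    using assms(1-4) z'[of x] z[of z'] by (simp add: m_assoc[symmetric]) (simp add: m_assoc)
  moreover have "inv (x \<otimes> z) \<otimes> inv (y \<otimes> z') = inv ((y \<otimes> z') \<otimes> (x \<otimes> z))"
    using assms(1-4) by (simp add: inv_mult_group)
  ultimately show ?thesis
    using assms(1-4) by (simp add: m_assoc inv_mult_group)
      (simp add: m_assoc[symmetric])
qed

text \<open>Multiplying the arguments by elements of a central section \<open>A/M\<close> of exponent \<open>p\<close> changes neither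
  \<open>p\<close>-th powers nor commutators modulo \<open>M\<close>. The proof is a computation in \<open>G/M\<close>.\<close>

lemma p_central_section_cong:
  assumes AM: "p_central G p A M"
    and xy: "x \<in> carrier G" "y \<in> carrier G" and ab: "a \<in> A" "b \<in> A"
  shows "(x \<otimes> a) [^] p \<otimes> inv (x [^] p) \<in> M"
    and "(x \<otimes> a) \<otimes> (y \<otimes> b) \<otimes> inv (x \<otimes> a) \<otimes> inv (y \<otimes> b) \<otimes>
          inv (x \<otimes> y \<otimes> inv x \<otimes> inv y) \<in> M"
proof -
  interpret M: normal M G by (rule p_central_normal[OF AM])
  interpret Q: group "G Mod M" by (rule M.factorgroup_is_group)
  interpret h: group_hom G "G Mod M" "\<lambda>x. M #> x"
    by (intro group_hom.intro group_hom_axioms.intro is_group Q.is_group M.r_coset_hom_Mod)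
  have AG: "c \<in> carrier G" if "c \<in> A" for c
    using AM that by (auto simp: p_central_def dest: subgroup.mem_carrier)
  note abG = AG[OF ab(1)] AG[OF ab(2)]
  have eqI: "M #> u = M #> v" if "u \<otimes> inv v \<in> M" "u \<in> carrier G" "v \<in> carrier G" for u v
    using M.rcos_module_rev[OF is_group that(3,2,1)] repr_independence[OF _ that(3) M.is_subgroup]
    by metis
  have eqD: "u \<otimes> inv v \<in> M" if "M #> u = M #> v" "u \<in> carrier G" "v \<in> carrier G" for u v
    using M.rcos_module_imp[OF is_group that(3)] rcos_self[OF that(2) M.is_subgroup] that(1) by simp
  have central: "(M #> c) \<otimes>\<^bsub>G Mod M\<^esub> g = g \<otimes>\<^bsub>G Mod M\<^esub> (M #> c)"
    if c: "c \<in> A" and g: "g \<in> carrier (G Mod M)" for c g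
  proof -
    obtain z where z: "z \<in> carrier G" "g = M #> z"
      using g by (auto simp: carrier_FactGroup)
    have "c \<otimes> z \<otimes> inv (z \<otimes> c) = c \<otimes> z \<otimes> inv c \<otimes> inv z"
      using z AG[OF c] by (simp add: inv_mult_group m_assoc)
    also have "\<dots> \<in> M" using AM c z by (simp add: p_central_def)
    finally have "M #> (c \<otimes> z) = M #> (z \<otimes> c)" using z AG[OF c] by (intro eqI) auto
    then show ?thesis using z AG[OF c] by (simp only: h.hom_mult)
  qed
  have pa: "(M #> a) [^]\<^bsub>G Mod M\<^esub> p = \<one>\<^bsub>G Mod M\<^esub>"
  proof -
    have "M #> (a [^] p) = M" using AM ab by (intro M.rcos_const[OF is_group]) (simp add: p_central_def)
    then show ?thesis using h.hom_nat_pow[OF abG(1), of p] by simp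
  qed
  have "M #> ((x \<otimes> a) [^] p) = ((M #> x) \<otimes>\<^bsub>G Mod M\<^esub> (M #> a)) [^]\<^bsub>G Mod M\<^esub> p"
    using xy abG by (simp only: h.hom_nat_pow h.hom_mult m_closed)
  also have "\<dots> = (M #> x) [^]\<^bsub>G Mod M\<^esub> p \<otimes>\<^bsub>G Mod M\<^esub> (M #> a) [^]\<^bsub>G Mod M\<^esub> p"
    by (rule Q.pow_mult_distrib) (use central[OF ab(1)] xy abG h.hom_closed in auto)
  also have "\<dots> = (M #> x) [^]\<^bsub>G Mod M\<^esub> p"
    unfolding pa by (rule Q.r_one) (use xy h.hom_closed in blast)
  also have "\<dots> = M #> (x [^] p)" by (rule h.hom_nat_pow[OF xy(1), symmetric])
  finally show "(x \<otimes> a) [^] p \<otimes> inv (x [^] p) \<in> M"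
    by (rule eqD) (use xy abG in auto)
  have "M #> ((x \<otimes> a) \<otimes> (y \<otimes> b) \<otimes> inv (x \<otimes> a) \<otimes> inv (y \<otimes> b)) = M #> (x \<otimes> y \<otimes> inv x \<otimes> inv y)"
    using Q.commutator_mult_central[OF h.hom_closed[OF xy(1)] h.hom_closed[OF xy(2)]
        h.hom_closed[OF abG(1)] h.hom_closed[OF abG(2)] central[OF ab(1)] central[OF ab(2)]]
      xy abG by (simp only: h.hom_mult h.hom_inv m_closed inv_closed)
  then show "(x \<otimes> a) \<otimes> (y \<otimes> b) \<otimes> inv (x \<otimes> a) \<otimes> inv (y \<otimes> b) \<otimes>
          inv (x \<otimes> y \<otimes> inv x \<otimes> inv y) \<in> M"
    by (rule eqD) (use xy abG in auto)
qed

text \<open>Powers and commutators formed from \<open>CA\<close> agree modulo \<open>M\<close> with those formed from \<open>C\<close>, so they already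
  lie in \<open>C\<close>. With \<open>D = C\<close> this shows that all subgroups \<open>C\<close> with the same product \<open>CA\<close> share the powers
  and commutators of that product; with \<open>D\<close> the whole group it gives the same for a normal \<open>C\<close> and the
  commutators with \<open>G\<close>.\<close>

lemma power_commutator_set_mult_central:
  assumes AM: "p_central G p A M" and C: "subgroup C G" and MC: "M \<subseteq> C"
    and D: "D \<subseteq> carrier G" and CD: "\<And>x y. x \<in> C \<Longrightarrow> y \<in> D \<Longrightarrow> x \<otimes> y \<otimes> inv x \<otimes> inv y \<in> C"
  shows "power_commutator G p (C <#> A) (D <#> A) \<subseteq> C"
proof (rule power_commutator_least[OF C])
  have AG: "A \<subseteq> carrier G" using AM by (auto simp: p_central_def dest: subgroup.subset)
  have lift: "u \<in> C" if "u \<otimes> inv v \<in> M" "v \<in> C" "u \<in> carrier G" for u v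
  proof -
    have "u = (u \<otimes> inv v) \<otimes> v"
      using that subgroup.mem_carrier[OF C] by (simp add: m_assoc)
    then show ?thesis using that MC subgroup.m_closed[OF C] by (metis subsetD)
  qed
  fix s assume "s \<in> C <#> A"
  then obtain x a where s: "s = x \<otimes> a" and x: "x \<in> C" and a: "a \<in> A" by (auto simp: set_mult_def)
  have xG: "x \<in> carrier G" and aG: "a \<in> carrier G"
    using x a AG subgroup.mem_carrier[OF C] by auto
  have "x [^] p \<in> C" using subgroup_int_pow_closed[OF C x, of "int p"] by (simp add: int_pow_int)
  then show "s [^] p \<in> C"
    unfolding s using p_central_section_cong(1)[OF AM xG xG a a] xG aG by (blast intro: lift)
  fix t assume "t \<in> D <#> A"
  then obtain y b where t: "t = y \<otimes> b" and y: "y \<in> D" and b: "b \<in> A" by (auto simp: set_mult_def)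
  have yG: "y \<in> carrier G" and bG: "b \<in> carrier G" using y b AG D by auto
  show "s \<otimes> t \<otimes> inv s \<otimes> inv t \<in> C"
    unfolding s t
    by (rule lift[OF p_central_section_cong(2)[OF AM xG yG a b] CD[OF x y]])
      (use xG yG aG bG in simp)
qed

text \<open>Adjoining to \<open>N\<close> an element of \<open>C\<close> outside \<open>N\<close> divides the index, a power of \<open>p\<close>, by at least \<open>p\<close>;
  so \<open>d\<close> additional generators suffice.\<close>

lemma ex_small_generating_set:
  assumes p: "Factorial_Ring.prime p" and fin: "finite (carrier G)"
    and C: "subgroup C G" and "subgroup N G" and "N \<subseteq> C" and "card C = p ^ d * card N"
  shows "\<exists>B\<subseteq>C. card B \<le> d \<and> generate G (N \<union> B) = C"
  using assms(4-6)
proof (induction d arbitrary: N rule: less_induct)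
  case (less d N)
  have finC: "finite C" by (rule finite_subset[OF subgroup.subset[OF C] fin])
  have N0: "card N > 0" using subgroup.finite_imp_card_positive[OF less.prems(1) fin] .
  have p1: "1 < p" using p by (rule prime_gt_1_nat)
  show ?case
  proof (cases "N = C")
    case True
    then have "generate G (N \<union> {}) = C"
      using generate_subgroup_incl[OF _ C, of C] generate.incl[of _ C G] by auto
    then show ?thesis by (intro exI[of _ "{}"]) auto
  next
    case False
    then obtain x where x: "x \<in> C" "x \<notin> N" using less.prems by blast
    let ?N = "generate G (insert x N)"
    have sub: "insert x N \<subseteq> carrier G" using x less.prems(2) subgroup.subset[OF C] by blast
    have N: "subgroup ?N G" by (rule generate_is_subgroup[OF sub])
    have N_sub: "insert x N \<subseteq> ?N" by (auto intro: generate.incl)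
    have NC: "?N \<subseteq> C" by (rule generate_subgroup_incl[OF _ C]) (use x less.prems in auto)
    have finN: "finite ?N" by (rule finite_subset[OF NC finC])
    \<comment> \<open>By Lagrange the index of the enlarged subgroup is a proper divisor of \<open>p ^ d\<close>.\<close>
    obtain k where k: "card ?N = k * card N"
      using card_subgroup_quotient[OF N less.prems(1)] N_sub by blast
    obtain l where l: "card C = l * card ?N"
      using card_subgroup_quotient[OF C N NC] by blast
    have "p ^ d = l * k" using k l less.prems(3) N0 by simp
    then obtain j where j: "l = p ^ j" "j \<le> d"
      using p by (metis divides_primepow_nat dvd_triv_left)
    have "N \<subset> ?N" using N_sub x by blast
    then have "card N < card ?N" by (rule psubset_card_mono[OF finN])
    then have "card C > p ^ j * card N" using l j p1 by simp
    then have "j \<noteq> d" using less.prems(3) by auto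
    then have "j < d" using j by simp
    from less.IH[OF this N NC] l j obtain B where
      B: "B \<subseteq> C" "card B \<le> j" and gen: "generate G (?N \<union> B) = C" by auto
    have "card (insert x B) \<le> d"
      using B(2) \<open>j < d\<close> card_insert_le_m1[of d B x] finite_subset[OF B(1) finC]
      by (simp add: card_insert_if)
    moreover have "generate G (N \<union> insert x B) = C"
    proof
      show "generate G (N \<union> insert x B) \<subseteq> C"
        by (rule generate_subgroup_incl[OF _ C]) (use B x less.prems in auto)
      have "subgroup (generate G (N \<union> insert x B)) G"
        by (rule generate_is_subgroup) (use B x less.prems subgroup.subset[OF C] in blast)
      moreover have "?N \<subseteq> generate G (N \<union> insert x B)"
        by (rule mono_generate) auto
      ultimately have "generate G (?N \<union> B) \<subseteq> generate G (N \<union> insert x B)"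
        by (intro generate_subgroup_incl) (auto intro: generate.incl)
      then show "C \<subseteq> generate G (N \<union> insert x B)" using gen by simp
    qed
    ultimately show ?thesis using B x by (intro exI[of _ "insert x B"]) auto
  qed
qed

text \<open>The members of \<open>\<C>\<close> are complements of \<open>A/M\<close> in \<open>T/M\<close>. For \<open>C\<close> in \<open>\<C>\<close> and \<open>c\<close> in a fixed complement
  \<open>C0\<close>, the elements \<open>a\<close> of \<open>A\<close> with \<open>ca \<in> C\<close> form a coset of \<open>M\<close>. The \<open>c\<close> on which two complements agree in
  this respect form a subgroup, which contains \<open>N\<close> because both complements contain \<open>N\<close>. Hence a
  complement is determined by the cosets assigned to at most \<open>d\<close> elements that together with \<open>N\<close> generate \<open>C0\<close>,
  and there are \<open>q\<close> cosets to choose from.\<close>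

lemma card_complements_le:
  assumes p: "Factorial_Ring.prime p" and fin: "finite (carrier G)" and A: "A \<lhd> G" and M: "M \<lhd> G"
    and MA: "M \<subseteq> A"
    and cA: "card A = q * card M"
    and \<C>: "\<And>C. C \<in> \<C> \<Longrightarrow> subgroup C G \<and> C \<inter> A = M \<and> C <#> A = T \<and> N \<subseteq> C"
    and C0: "C0 \<in> \<C>" and N: "subgroup N G" and cC0: "card C0 = p ^ d * card N"
  shows "card \<C> \<le> q ^ d"
proof -
  interpret A: normal A G by (rule A)
  interpret M: normal M G by (rule M)
  have M0: "card M > 0" using M.finite_imp_card_positive[OF fin] .
  have A0: "card A > 0" using A.finite_imp_card_positive[OF fin] .
  have sC0: "subgroup C0 G" and TC0: "C0 <#> A = T" using \<C>[OF C0] by auto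
  obtain B where BC: "B \<subseteq> C0" and cB: "card B \<le> d" and gen: "generate G (N \<union> B) = C0"
    using ex_small_generating_set[OF p fin sC0 N _ cC0] \<C>[OF C0] by blast
  have finB: "finite B"
    using finite_subset[OF BC finite_subset[OF subgroup.subset[OF sC0] fin]] .
  let ?R = "rcosets\<^bsub>G\<lparr>carrier := A\<rparr>\<^esub> M"
  have cR: "card ?R = q"
    using card_subgroup_quotient[OF A.is_subgroup M.is_subgroup MA] cA M0 by simp
  have q0: "q > 0" using cA A0 by (cases q) auto
  define \<phi> where "\<phi> C = (\<lambda>c. {a \<in> A. c \<otimes> a \<in> C})" for C
  have nonempty: "\<exists>a. a \<in> \<phi> C c" if C: "C \<in> \<C>" and c: "c \<in> C0" for C c
  proof -
    have sC: "subgroup C G" and TC: "C <#> A = T" using \<C>[OF C] by auto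
    have "c \<in> C <#> A"
      using set_mult_upper1[OF sC0 A.is_subgroup] c TC TC0 by blast
    then obtain x a where xa: "x \<in> C" "a \<in> A" "c = x \<otimes> a" by (auto simp: set_mult_def)
    then have "c \<otimes> inv a = x" using subgroup.mem_carrier[OF sC] by (simp add: m_assoc)
    then show ?thesis using xa by (auto simp: \<phi>_def intro!: exI[of _ "inv a"])
  qed
  have diff: "inv b \<otimes> a \<in> M" if C: "C \<in> \<C>" and c: "c \<in> carrier G" and "a \<in> \<phi> C c" "b \<in> \<phi> C c" for C c a b
  proof -
    have sC: "subgroup C G" and CA: "C \<inter> A = M" using \<C>[OF C] by auto
    have ab: "a \<in> A" "b \<in> A" "c \<otimes> a \<in> C" "c \<otimes> b \<in> C" using that by (auto simp: \<phi>_def)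
    then have "inv (c \<otimes> b) \<otimes> (c \<otimes> a) \<in> C"
      using subgroup.m_closed[OF sC] subgroup.m_inv_closed[OF sC] by blast
    also have "inv (c \<otimes> b) \<otimes> (c \<otimes> a) = inv b \<otimes> ((inv c \<otimes> c) \<otimes> a)"
      using A.mem_carrier[OF ab(1)] A.mem_carrier[OF ab(2)] c
      by (simp only: inv_mult_group m_assoc inv_closed m_closed)
    also have "\<dots> = inv b \<otimes> a" using ab c A.mem_carrier by simp
    finally show ?thesis using ab CA by blast
  qed
  have coset: "\<phi> C c \<in> ?R" if C: "C \<in> \<C>" and c: "c \<in> C0" for C c
  proof -
    have sC: "subgroup C G" and CA: "C \<inter> A = M" using \<C>[OF C] by auto
    have cG: "c \<in> carrier G" using c subgroup.mem_carrier[OF sC0] by simp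
    obtain b where b: "b \<in> \<phi> C c" using nonempty[OF C c] by blast
    then have bA: "b \<in> A" and cb: "c \<otimes> b \<in> C" by (auto simp: \<phi>_def)
    have "\<phi> C c = b <# M"
    proof
      show "\<phi> C c \<subseteq> b <# M"
      proof
        fix a assume a: "a \<in> \<phi> C c"
        then have aG: "a \<in> carrier G" using A.mem_carrier by (auto simp: \<phi>_def)
        have "b \<otimes> (inv b \<otimes> a) = (b \<otimes> inv b) \<otimes> a"
          using aG bA A.mem_carrier by (simp only: m_assoc inv_closed)
        then have "a = b \<otimes> (inv b \<otimes> a)" using aG bA A.mem_carrier by simp
        then show "a \<in> b <# M" using diff[OF C cG a b] by (auto simp: l_coset_def)
      qed
      show "b <# M \<subseteq> \<phi> C c"
      proof
        fix a assume "a \<in> b <# M"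
        then obtain m where m: "m \<in> M" "a = b \<otimes> m" by (auto simp: l_coset_def)
        have "c \<otimes> a = (c \<otimes> b) \<otimes> m"
          using m cG bA A.mem_carrier M.mem_carrier by (simp add: m_assoc)
        moreover have "m \<in> C" using m CA by blast
        ultimately have "c \<otimes> a \<in> C" using cb subgroup.m_closed[OF sC] by simp
        then show "a \<in> \<phi> C c" using m bA MA by (auto simp: \<phi>_def)
      qed
    qed
    also have "\<dots> = M #> b" using M.coset_eq bA A.mem_carrier by blast
    finally show ?thesis using bA by (auto simp: RCOSETS_def r_coset_def)
  qed
  have sub: "C \<subseteq> C'"
    if C: "C \<in> \<C>" and C': "C' \<in> \<C>" and eq: "\<And>c. c \<in> B \<Longrightarrow> \<phi> C c = \<phi> C' c" for C C'
  proof -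
    have sC: "subgroup C G" and CA: "C \<inter> A = M" and TC: "C <#> A = T" and NC: "N \<subseteq> C"
      using \<C>[OF C] by auto
    have sC': "subgroup C' G" and CA': "C' \<inter> A = M" and NC': "N \<subseteq> C'"
      using \<C>[OF C'] by auto
    \<comment> \<open>The elements of \<open>C0\<close> on which \<open>C\<close> and \<open>C'\<close> agree. As \<open>A\<close> is normal, its elements
      can be moved past those of \<open>C0\<close>.\<close>
    define D where "D = {c \<in> C0. \<exists>a\<in>A. c \<otimes> a \<in> C \<and> c \<otimes> a \<in> C'}"
    have "subgroup D G"
    proof (rule subgroupI)
      show "D \<subseteq> carrier G" using subgroup.subset[OF sC0] by (auto simp: D_def)
      have "\<one> \<in> D"
        unfolding D_def using subgroup.one_closed sC0 sC sC' by (auto intro!: bexI[of _ \<one>])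
      then show "D \<noteq> {}" by blast
    next
      fix c assume "c \<in> D"
      then obtain a where c: "c \<in> C0" and a: "a \<in> A" "c \<otimes> a \<in> C" "c \<otimes> a \<in> C'" by (auto simp: D_def)
      have cG: "c \<in> carrier G" using c subgroup.mem_carrier[OF sC0] by simp
      have aG: "a \<in> carrier G" using a A.mem_carrier by simp
      have "inv c \<otimes> (c \<otimes> inv a \<otimes> inv c) = (inv c \<otimes> c) \<otimes> (inv a \<otimes> inv c)"
        using cG aG by (simp only: m_assoc inv_closed m_closed)
      then have "inv c \<otimes> (c \<otimes> inv a \<otimes> inv c) = inv (c \<otimes> a)"
        using cG aG by (simp add: inv_mult_group)
      moreover have "c \<otimes> inv a \<otimes> inv c \<in> A"
        using A.inv_op_closed2[OF cG] a by simp
      ultimately show "inv c \<in> D"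
        unfolding D_def using subgroup.m_inv_closed[OF sC0 c]
          subgroup.m_inv_closed[OF sC a(2)] subgroup.m_inv_closed[OF sC' a(3)]
        by (auto intro!: bexI[of _ "c \<otimes> inv a \<otimes> inv c"])
    next
      fix c c' assume "c \<in> D" "c' \<in> D"
      then obtain a a' where c: "c \<in> C0" "c' \<in> C0" and a: "a \<in> A" "c \<otimes> a \<in> C" "c \<otimes> a \<in> C'"
        and a': "a' \<in> A" "c' \<otimes> a' \<in> C" "c' \<otimes> a' \<in> C'"
        by (auto simp: D_def)
      have cG: "c \<in> carrier G" "c' \<in> carrier G" using c subgroup.mem_carrier[OF sC0] by auto
      have aG: "a \<in> carrier G" "a' \<in> carrier G" using a a' A.mem_carrier by auto
      have "(c \<otimes> c') \<otimes> (inv c' \<otimes> a \<otimes> c' \<otimes> a') = c \<otimes> ((c' \<otimes> inv c') \<otimes> (a \<otimes> (c' \<otimes> a')))"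
        using cG aG by (simp only: m_assoc inv_closed m_closed)
      then have "(c \<otimes> c') \<otimes> (inv c' \<otimes> a \<otimes> c' \<otimes> a') = (c \<otimes> a) \<otimes> (c' \<otimes> a')"
        using cG aG by (simp add: m_assoc)
      moreover have "inv c' \<otimes> a \<otimes> c' \<otimes> a' \<in> A"
        using A.inv_op_closed1[OF cG(2)] a a' by simp
      ultimately show "c \<otimes> c' \<in> D"
        unfolding D_def using subgroup.m_closed[OF sC0 c]
          subgroup.m_closed[OF sC a(2) a'(2)] subgroup.m_closed[OF sC' a(3) a'(3)]
        by (auto intro!: bexI[of _ "inv c' \<otimes> a \<otimes> c' \<otimes> a'"])
    qed
    moreover have "N \<union> B \<subseteq> D"
    proof
      fix c assume c: "c \<in> N \<union> B"
      then have c0: "c \<in> C0" using BC \<C>[OF C0] by blast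
      have "\<exists>a\<in>A. c \<otimes> a \<in> C \<and> c \<otimes> a \<in> C'"
      proof (cases "c \<in> N")
        case True
        then have "c \<otimes> \<one> \<in> C" "c \<otimes> \<one> \<in> C'"
          using NC NC' subgroup.mem_carrier[OF N] by auto
        then show ?thesis by (intro bexI[OF _ A.one_closed] conjI)
      next
        case False
        then have "c \<in> B" using c by blast
        then have "\<phi> C c = \<phi> C' c" by (rule eq)
        moreover obtain a where "a \<in> \<phi> C c" using nonempty[OF C c0] by blast
        ultimately have "a \<in> \<phi> C c" "a \<in> \<phi> C' c" by simp_all
        then show ?thesis unfolding \<phi>_def by blast
      qed
      with c0 show "c \<in> D" by (simp add: D_def)
    qed
    ultimately have D: "C0 \<subseteq> D" using generate_subgroup_incl gen by blast
    show "C \<subseteq> C'"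
    proof
      fix x assume x: "x \<in> C"
      then have "x \<in> C0 <#> A"
        using set_mult_upper1[OF sC A.is_subgroup] TC TC0 by blast
      then obtain c a where c: "c \<in> C0" and a: "a \<in> A" and x_eq: "x = c \<otimes> a"
        by (auto simp: set_mult_def)
      obtain b where b: "b \<in> A" "c \<otimes> b \<in> C" "c \<otimes> b \<in> C'" using D c by (auto simp: D_def)
      have cG: "c \<in> carrier G" using c subgroup.mem_carrier[OF sC0] by simp
      have abG: "a \<in> carrier G" "b \<in> carrier G" using a b A.mem_carrier by auto
      have "inv b \<otimes> a \<in> M"
        by (rule diff[OF C cG]) (use a b x x_eq in \<open>auto simp: \<phi>_def\<close>)
      then have "(c \<otimes> b) \<otimes> (inv b \<otimes> a) \<in> C'"
        using b CA' subgroup.m_closed[OF sC'] by blast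
      also have "(c \<otimes> b) \<otimes> (inv b \<otimes> a) = c \<otimes> ((b \<otimes> inv b) \<otimes> a)"
        using cG abG by (simp only: m_assoc inv_closed m_closed)
      also have "\<dots> = x" using x_eq cG abG by simp
      finally show "x \<in> C'" .
    qed
  qed
  have "card \<C> \<le> card (B \<rightarrow>\<^sub>E ?R)"
  proof (rule card_inj_on_le)
    show "inj_on (\<lambda>C. restrict (\<phi> C) B) \<C>"
    proof (rule inj_onI)
      fix C C' assume C: "C \<in> \<C>" "C' \<in> \<C>" and "restrict (\<phi> C) B = restrict (\<phi> C') B"
      then have "\<phi> C c = \<phi> C' c" if "c \<in> B" for c
        using that by (metis restrict_apply')
      then show "C = C'" using sub[OF C] sub[OF C(2,1)] by fastforce
    qed
    show "(\<lambda>C. restrict (\<phi> C) B) ` \<C> \<subseteq> B \<rightarrow>\<^sub>E ?R"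
      using coset BC by auto
    show "finite (B \<rightarrow>\<^sub>E ?R)"
      using finB cR q0 by (intro finite_PiE) (auto intro: card_ge_0_finite)
  qed
  also have "\<dots> = q ^ card B" using finB cR by (simp add: card_PiE)
  also have "\<dots> \<le> q ^ d" using cB q0 by (simp add: power_increasing)
  finally show ?thesis .
qed

end

section \<open>Counting layer by layer\<close>

lemma card_image_le_fibres:
  fixes K :: real
  assumes "finite S" and "f ` S \<subseteq> T" and "finite T" and "\<And>y. y \<in> T \<Longrightarrow> real (card {x \<in> S. f x = y}) \<le> K"
  shows "real (card S) \<le> real (card T) * K"
proof -
  have "card S = card (\<Union>y\<in>T. {x \<in> S. f x = y})"
    using assms(2) by (intro arg_cong[of _ _ card]) auto
  also have "\<dots> \<le> (\<Sum>y\<in>T. card {x \<in> S. f x = y})"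
    by (rule card_UN_le[OF assms(3)])
  finally have "real (card S) \<le> (\<Sum>y\<in>T. real (card {x \<in> S. f x = y}))"
    by (simp flip: of_nat_sum)
  also have "\<dots> \<le> real (card T) * K"
    using sum_bounded_above[of T, OF assms(4)] by simp
  finally show ?thesis .
qed

context group
begin

text \<open>Once the product \<open>T = CG\<^sub>i\<close> and the intersection \<open>M = C \<inter> G\<^sub>i\<close> are fixed, the subgroups
  \<open>C = UG\<^sub>i\<^sub>+\<^sub>1\<close> are complements of \<open>G\<^sub>i/M\<close> in \<open>T/M\<close>. Choose \<open>U\<close> such that \<open>UG\<^sub>i\<^sub>+\<^sub>1\<close> is one of
  them. Then all of them contain \<open>U\<^sub>2M\<close>, and the index of \<open>U\<^sub>2M\<close> in \<open>UG\<^sub>i\<^sub>+\<^sub>1\<close> equals the index of \<open>U\<^sub>2G\<^sub>i\<close> in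
  \<open>UG\<^sub>i\<close>. This is a power of \<open>p\<close> whose exponent is the sum of the layer dimensions of \<open>U\<close> below \<open>i\<close>
  minus that of \<open>U\<^sub>2\<close>.\<close>

lemma card_lifts_with_intersection_le:
  fixes v :: "nat \<Rightarrow> int"
  assumes p: "Factorial_Ring.prime p" and fin: "finite (carrier G)" and i: "1 \<le> i"
    and AN: "p_central G p (lower_p_series G p i) M"
    and cA: "card (lower_p_series G p i) = p ^ e * card M"
    and LM: "lower_p_series G p (Suc i) \<subseteq> M"
    and S: "\<And>U. U \<in> S \<Longrightarrow> U \<lhd> G"
    and u: "\<And>U j. U \<in> S \<Longrightarrow> j \<in> {1..<i} \<Longrightarrow> layer_dim G p U j = u j"
    and v: "\<And>U j. U \<in> S \<Longrightarrow> j \<in> {1..<i} \<Longrightarrow>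
              v j \<le> int (layer_dim G p (power_commutator G p U U) j)"
    and \<C>: "\<C> = {C \<in> (\<lambda>U. U <#> lower_p_series G p (Suc i)) ` S.
             C <#> lower_p_series G p i = T \<and> C \<inter> lower_p_series G p i = M}"
  shows "real (card \<C>) \<le> real p powi (int e * (\<Sum>j=1..<i. int (u j) - v j))"
proof (cases "\<C> = {}")
  case True
  then show ?thesis by simp
next
  case False
  let ?A = "lower_p_series G p i"
  have p1: "1 < p" using p by (rule prime_gt_1_nat)
  have A: "?A \<lhd> G" and M: "M \<lhd> G" using p_central_normal[OF AN] by auto
  have MA: "M \<subseteq> ?A" using AN by (simp add: p_central_def)
  have L: "lower_p_series G p (Suc i) \<lhd> G" by (rule lower_p_series_normal)
  have LA: "lower_p_series G p (Suc i) \<subseteq> ?A" using LM MA by blast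
  have A0: "card ?A > 0" and M0: "card M > 0"
    using subgroup.finite_imp_card_positive[OF _ fin] normal_imp_subgroup A M by auto
  have subC: "subgroup C G" if "C \<in> \<C>" for C
    using that S L unfolding \<C> by (auto intro: subgroup_set_mult_normal normal_imp_subgroup)
  obtain C0 U where C0: "C0 \<in> \<C>" and U: "U \<in> S" and C0_eq: "C0 = U <#> lower_p_series G p (Suc i)"
    using False unfolding \<C> by auto
  have nU: "U \<lhd> G" by (rule S[OF U])
  have sU: "subgroup U G" by (rule normal_imp_subgroup[OF nU])
  have UC0: "U \<subseteq> C0"
    unfolding C0_eq by (rule set_mult_upper1[OF sU normal_imp_subgroup[OF L]])
  let ?P = "power_commutator G p U U"
  have P: "?P \<lhd> G" by (rule power_commutator_normal[OF nU nU])
  let ?N = "?P <#> M"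
  have N: "?N \<lhd> G" by (rule normal_subgroup_set_mult_closed[OF P M])
  have T: "C <#> ?A = T" and CA: "C \<inter> ?A = M" if "C \<in> \<C>" for C
    using that unfolding \<C> by auto
  have NC: "?N \<subseteq> C" if C: "C \<in> \<C>" for C
  proof (rule set_mult_least[OF subC[OF C]])
    show MC: "M \<subseteq> C" using CA[OF C] by blast
    have UT: "U \<subseteq> C <#> ?A"
      using UC0 set_mult_upper1[OF subC[OF C0] normal_imp_subgroup[OF A]] T[OF C] T[OF C0] by blast
    have "?P \<subseteq> power_commutator G p (C <#> ?A) (C <#> ?A)"
      by (rule power_commutator_mono[OF UT UT])
    also have "\<dots> \<subseteq> C"
      using subgroup.m_closed[OF subC[OF C]] subgroup.m_inv_closed[OF subC[OF C]]
      by (intro power_commutator_set_mult_central[OF AN subC[OF C] MC subgroup.subset[OF subC[OF C]]])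
        auto
    finally show "?P \<subseteq> C" .
  qed
  define su where "su = (\<Sum>j=1..<i. u j)"
  define sv where "sv = (\<Sum>j=1..<i. layer_dim G p ?P j)"
  have "card (C0 <#> ?A) * card M = card C0 * card ?A"
    using card_set_mult_normal[OF subC[OF C0] A] CA[OF C0] by simp
  moreover have "C0 <#> ?A = U <#> ?A"
    unfolding C0_eq by (rule set_mult_absorb[OF sU L A LA])
  moreover have "card (U <#> ?A) = p ^ su * card ?A"
    unfolding card_set_mult_lower_p_series[OF p fin sU i] su_def using u[OF U] by simp
  ultimately have cC0: "card C0 = p ^ su * card M" using A0 by simp
  have "card (?N <#> ?A) * card M = card ?N * card ?A"
  proof -
    have "?N \<inter> ?A = M"
      using NC[OF C0] CA[OF C0] set_mult_upper2[OF normal_imp_subgroup[OF P] normal_imp_subgroup[OF M]]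
        MA by blast
    then show ?thesis using card_set_mult_normal[OF normal_imp_subgroup[OF N] A] by simp
  qed
  moreover have "?N <#> ?A = ?P <#> ?A"
    by (rule set_mult_absorb[OF normal_imp_subgroup[OF P] M A MA])
  moreover have "card (?P <#> ?A) = p ^ sv * card ?A"
    unfolding sv_def by (rule card_set_mult_lower_p_series[OF p fin normal_imp_subgroup[OF P] i])
  ultimately have cN: "card ?N = p ^ sv * card M" using A0 by simp
  have "card ?N \<le> card C0"
    using NC[OF C0] finite_subset[OF subgroup.subset[OF subC[OF C0]] fin] by (rule card_mono[rotated])
  then have "sv \<le> su" using cC0 cN M0 p1 by simp
  then have "card C0 = p ^ (su - sv) * card ?N"
    unfolding cC0 cN by (simp flip: power_add)
  then have "card \<C> \<le> (p ^ e) ^ (su - sv)"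
    using subC CA T NC
    by (intro card_complements_le[OF p fin A M MA cA _ C0 normal_imp_subgroup[OF N], of T]) auto
  then have "real (card \<C>) \<le> real (p ^ (e * (su - sv)))"
    by (simp only: of_nat_le_iff power_mult)
  also have "\<dots> = real p powi (int e * int (su - sv))"
    by (simp flip: of_nat_mult add: power_int_def)
  also have "\<dots> \<le> real p powi (int e * (\<Sum>j=1..<i. int (u j) - v j))"
  proof (rule power_int_increasing)
    have "int (su - sv) = (\<Sum>j=1..<i. int (u j) - int (layer_dim G p ?P j))"
      using \<open>sv \<le> su\<close> by (simp add: su_def sv_def of_nat_diff sum_subtractf)
    also have "\<dots> \<le> (\<Sum>j=1..<i. int (u j) - v j)"
      using v[OF U] by (intro sum_mono) simp
    finally show "int e * int (su - sv) \<le> int e * (\<Sum>j=1..<i. int (u j) - v j)"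
      by (rule mult_left_mono) simp
  qed (use p1 in auto)
  finally show ?thesis .
qed

lemma card_layer:
  assumes "Factorial_Ring.prime p" "finite (carrier G)" "subgroup H G" "1 \<le> i"
  shows "card ((H <#> lower_p_series G p (Suc i)) \<inter> lower_p_series G p i) =
    p ^ layer_dim G p H i * card (lower_p_series G p (Suc i))"
  unfolding layer_subgroup(2)[OF assms(3,4)]
  by (rule card_p_central[OF assms(1,2) layer_subgroup(1)[OF assms(3,4)]])

text \<open>Sort the subgroups \<open>C = UG\<^sub>i\<^sub>+\<^sub>1\<close> first by the product \<open>T = CG\<^sub>i\<close> and then by the intersection
  \<open>M = C \<inter> G\<^sub>i\<close>. The group \<open>T\<^sup>p[T,G]G\<^sub>i\<^sub>+\<^sub>1 \<inter> G\<^sub>i\<close> depends on \<open>T\<close> alone and lies in every such \<open>M\<close>, and its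
  dimension over \<open>G\<^sub>i\<^sub>+\<^sub>1\<close> is at least \<open>w\<close>. This leaves a Gaussian coefficient of choices for \<open>M\<close>, and the
  complement count bounds the choices of \<open>C\<close> for each \<open>M\<close>.\<close>

lemma card_images_step:
  fixes v :: "nat \<Rightarrow> int" and w :: int
  assumes p: "Factorial_Ring.prime p" and fin: "finite (carrier G)" and i: "1 \<le> i"
    and g: "g = section_dim G p (lower_p_series G p i) (lower_p_series G p (Suc i))"
    and S: "\<And>U. U \<in> S \<Longrightarrow> U \<lhd> G"
    and u: "\<And>U j. U \<in> S \<Longrightarrow> j \<in> {1..i} \<Longrightarrow> layer_dim G p U j = u j"
    and v: "\<And>U j. U \<in> S \<Longrightarrow> j \<in> {1..<i} \<Longrightarrow>
              v j \<le> int (layer_dim G p (power_commutator G p U U) j)"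
    and w: "\<And>U. U \<in> S \<Longrightarrow> w \<le> int (layer_dim G p (power_commutator G p U (carrier G)) i)"
  shows "real (card ((\<lambda>U. U <#> lower_p_series G p (Suc i)) ` S)) \<le>
    real (card ((\<lambda>U. U <#> lower_p_series G p i) ` S)) *
    (real (gaussian_coeff p (int g - w) (int (u i) - w)) *
     real p powi ((int g - int (u i)) * (\<Sum>j=1..<i. int (u j) - v j)))"
proof -
  let ?A = "lower_p_series G p i" and ?L = "lower_p_series G p (Suc i)"
  let ?K = "real p powi ((int g - int (u i)) * (\<Sum>j=1..<i. int (u j) - v j))"
  have p1: "1 < p" using p by (rule prime_gt_1_nat)
  note c = p_central_lower_p_series[OF i, of p]
  have A: "?A \<lhd> G" and L: "?L \<lhd> G" by (rule lower_p_series_normal)+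
  have sA: "subgroup ?A G" and sL: "subgroup ?L G" and LA: "?L \<subseteq> ?A"
    using c by (auto simp: p_central_def)
  have L0: "card ?L > 0" using subgroup.finite_imp_card_positive[OF sL fin] .
  have finA: "finite ?A" by (rule finite_subset[OF subgroup.subset[OF sA] fin])
  have cA: "card ?A = p ^ g * card ?L" unfolding g by (rule card_p_central[OF p fin c])
  have "S \<subseteq> Pow (carrier G)" using S normal_imp_subgroup subgroup.subset by blast
  then have finS: "finite S" using fin by (simp add: finite_subset)
  have absorb: "(U <#> ?L) <#> ?A = U <#> ?A" if "U \<in> S" for U
    by (rule set_mult_absorb[OF normal_imp_subgroup[OF S[OF that]] L A LA])
  have pow_le: "a \<le> b" if "p ^ a * card ?L \<le> p ^ b * card ?L" for a b :: nat
    using that L0 p1 by simp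
  show ?thesis
  proof (rule card_image_le_fibres[where f = "\<lambda>C. C <#> ?A"])
    show "finite ((\<lambda>U. U <#> ?L) ` S)" "finite ((\<lambda>U. U <#> ?A) ` S)"
      using finS by auto
    show "(\<lambda>C. C <#> ?A) ` (\<lambda>U. U <#> ?L) ` S \<subseteq> (\<lambda>U. U <#> ?A) ` S"
      using absorb by auto
  next
    fix T assume "T \<in> (\<lambda>U. U <#> ?A) ` S"
    then obtain U0 where U0: "U0 \<in> S" and T: "T = U0 <#> ?A" by blast
    have nT: "T \<lhd> G" unfolding T by (rule normal_subgroup_set_mult_closed[OF S[OF U0] A])
    let ?F = "{C \<in> (\<lambda>U. U <#> ?L) ` S. C <#> ?A = T}"
    let ?P = "power_commutator G p T (carrier G)"
    have sP: "subgroup ?P G"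
      by (rule normal_imp_subgroup[OF power_commutator_normal[OF nT normal_self]])
    \<comment> \<open>This part of \<open>G\<^sub>i\<close> is known from \<open>T\<close> and lies in every lift of \<open>T\<close>.\<close>
    define W where "W = (?P <#> ?L) \<inter> ?A"
    define w' where "w' = layer_dim G p ?P i"
    have W: "p_central G p W ?L" unfolding W_def by (rule layer_subgroup(1)[OF sP i])
    have sW: "subgroup W G" and LW: "?L \<subseteq> W" using W by (auto simp: p_central_def)
    have cW: "card W = p ^ w' * card ?L"
      unfolding W_def w'_def by (rule card_layer[OF p fin sP i])
    have AW: "p_central G p ?A W"
      by (rule p_central_upper[OF c sW LW]) (simp add: W_def)
    have "w \<le> int w'"
    proof -
      let ?Q = "power_commutator G p U0 (carrier G)"
      have sQ: "subgroup ?Q G"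
        by (rule normal_imp_subgroup[OF power_commutator_normal[OF S[OF U0] normal_self]])
      have "U0 \<subseteq> T"
        unfolding T by (rule set_mult_upper1[OF normal_imp_subgroup[OF S[OF U0]] sA])
      then have "(?Q <#> ?L) \<inter> ?A \<subseteq> W"
        unfolding W_def by (intro Int_mono mono_set_mult power_commutator_mono) auto
      then have "card ((?Q <#> ?L) \<inter> ?A) \<le> card W"
        using finA by (intro card_mono) (auto simp: W_def)
      then have "layer_dim G p ?Q i \<le> w'"
        unfolding card_layer[OF p fin sQ i] cW by (rule pow_le)
      then show ?thesis using w[OF U0] by simp
    qed
    have WC: "W \<subseteq> C \<inter> ?A" and card_CA: "card (C \<inter> ?A) = p ^ u i * card ?L"
      and sCA: "subgroup (C \<inter> ?A) G" if C: "C \<in> ?F" for C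
    proof -
      obtain U where U: "U \<in> S" and C_eq: "C = U <#> ?L" using C by blast
      have nC: "C \<lhd> G" unfolding C_eq by (rule normal_subgroup_set_mult_closed[OF S[OF U] L])
      then have sC: "subgroup C G" by (rule normal_imp_subgroup)
      have LC: "?L \<subseteq> C"
        unfolding C_eq by (rule set_mult_upper2[OF normal_imp_subgroup[OF S[OF U]] sL])
      have "carrier G <#> ?A = carrier G"
        using set_mult_upper1[OF subgroup_self sA] set_mult_least[OF subgroup_self _ subgroup.subset[OF sA]]
        by blast
      then have "?P = power_commutator G p (C <#> ?A) (carrier G <#> ?A)" using C by simp
      also have "\<dots> \<subseteq> C"
      proof (rule power_commutator_set_mult_central[OF c sC LC order_refl])
        fix x y assume x: "x \<in> C" and y: "y \<in> carrier G"
        have "x \<otimes> y \<otimes> inv x \<otimes> inv y = x \<otimes> (y \<otimes> inv x \<otimes> inv y)"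
          using x y subgroup.mem_carrier[OF sC] by (simp add: m_assoc)
        then show "x \<otimes> y \<otimes> inv x \<otimes> inv y \<in> C"
          using x y normal.inv_op_closed2[OF nC y] subgroup.m_closed[OF sC] subgroup.m_inv_closed[OF sC]
          by simp
      qed
      finally have "?P <#> ?L \<subseteq> C" using LC by (rule set_mult_least[OF sC])
      then show "W \<subseteq> C \<inter> ?A" unfolding W_def by blast
      show "card (C \<inter> ?A) = p ^ u i * card ?L"
        unfolding C_eq card_layer[OF p fin normal_imp_subgroup[OF S[OF U]] i] using u[OF U] i by simp
      show "subgroup (C \<inter> ?A) G" by (rule subgroups_Inter_pair[OF sC sA])
    qed
    have "U0 <#> ?L \<in> ?F" using U0 absorb[OF U0] T by blast
    from WC[OF this] card_CA[OF this]
    have le: "p ^ w' * card ?L \<le> p ^ u i * card ?L" "p ^ u i * card ?L \<le> p ^ g * card ?L"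
      using card_mono[of "(U0 <#> ?L) \<inter> ?A" W] card_mono[of ?A "(U0 <#> ?L) \<inter> ?A"] finA
      by (auto simp: cW cA simp del: mult_le_cancel2)
    have wu: "w' \<le> u i" and ug: "u i \<le> g" using le by (simp_all only: pow_le)
    let ?M = "{M. subgroup M G \<and> W \<subseteq> M \<and> M \<subseteq> ?A \<and> card M = p ^ (u i - w') * card W}"
    have cM: "card M = p ^ u i * card ?L" if "M \<in> ?M" for M
      using that wu by (simp add: cW flip: power_add mult.assoc)
    have "card ?A = p ^ (g - w') * card W"
      using wu ug by (simp add: cW cA flip: power_add mult.assoc)
    then have "card ?M \<le> gaussian_coeff p (int (g - w')) (int (u i - w'))"
      by (rule card_intermediate_subgroups_le_gaussian_coeff[OF p fin AW])
    \<comment> \<open>The exact dimension \<open>w'\<close> may depend on \<open>T\<close>; the bound \<open>w\<close> does not.\<close>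
    also have "\<dots> \<le> gaussian_coeff p (int (g - w') + (int w' - w)) (int (u i - w') + (int w' - w))"
      using \<open>w \<le> int w'\<close> by (intro gaussian_coeff_mono_add[OF p]) simp
    also have "\<dots> = gaussian_coeff p (int g - w) (int (u i) - w)"
      using wu ug by (simp add: of_nat_diff)
    finally have card_M: "card ?M \<le> gaussian_coeff p (int g - w) (int (u i) - w)" .
    have "real (card ?F) \<le> real (card ?M) * ?K"
    proof (rule card_image_le_fibres[where f = "\<lambda>C. C \<inter> ?A"])
      show "finite ?F" using finS by simp
      show "finite ?M" by (rule finite_subset[of _ "Pow ?A"]) (use finA in auto)
      show "(\<lambda>C. C \<inter> ?A) ` ?F \<subseteq> ?M"
        using WC card_CA sCA wu by (auto simp: cW simp flip: power_add mult.assoc)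
    next
      fix M assume M: "M \<in> ?M"
      have AM: "p_central G p ?A M" by (rule p_central_upper[OF AW]) (use M in auto)
      have "card ?A = p ^ (g - u i) * card M"
        using ug by (simp add: cM[OF M] cA flip: power_add mult.assoc)
      then have "real (card {C \<in> ?F. C \<inter> ?A = M}) \<le>
          real p powi (int (g - u i) * (\<Sum>j=1..<i. int (u j) - v j))"
        using M LW u v
        by (intro card_lifts_with_intersection_le[OF p fin i AM _ _ S, where T = T]) auto
      then show "real (card {C \<in> ?F. C \<inter> ?A = M}) \<le> ?K" using ug by (simp add: of_nat_diff)
    qed
    also have "\<dots> \<le> real (gaussian_coeff p (int g - w) (int (u i) - w)) * ?K"
      using card_M p1 by (intro mult_right_mono) auto
    finally show "real (card ?F) \<le> real (gaussian_coeff p (int g - w) (int (u i) - w)) * ?K" .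
  qed
qed

lemma card_images_base:
  assumes p: "Factorial_Ring.prime p" and fin: "finite (carrier G)"
    and g: "g = section_dim G p (lower_p_series G p 1) (lower_p_series G p 2)"
    and S: "\<And>U. U \<in> S \<Longrightarrow> U \<lhd> G"
    and u: "\<And>U. U \<in> S \<Longrightarrow> layer_dim G p U 1 = u"
  shows "card ((\<lambda>U. U <#> lower_p_series G p 2) ` S) \<le> gaussian_coeff p (int g) (int u)"
proof -
  let ?L = "lower_p_series G p 2"
  have c: "p_central G p (carrier G) ?L"
    using p_central_lower_p_series[of 1 p] by (simp add: numeral_2_eq_2)
  have sL: "subgroup ?L G" by (rule normal_imp_subgroup[OF lower_p_series_normal])
  have "card (carrier G) = p ^ g * card ?L"
    using card_p_central[OF p fin c] g by simp
  then have "card {B. subgroup B G \<and> ?L \<subseteq> B \<and> B \<subseteq> carrier G \<and> card B = p ^ u * card ?L}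
      \<le> gaussian_coeff p (int g) (int u)"
    by (rule card_intermediate_subgroups_le_gaussian_coeff[OF p fin c])
  moreover have "(\<lambda>U. U <#> ?L) ` S \<subseteq> {B. subgroup B G \<and> ?L \<subseteq> B \<and> B \<subseteq> carrier G \<and> card B = p ^ u * card ?L}"
  proof (intro image_subsetI CollectI conjI)
    fix U assume U: "U \<in> S"
    note sU = normal_imp_subgroup[OF S[OF U]]
    show sB: "subgroup (U <#> ?L) G" by (rule subgroup_set_mult_normal[OF sU lower_p_series_normal])
    show "?L \<subseteq> U <#> ?L" by (rule set_mult_upper2[OF sU sL])
    show "U <#> ?L \<subseteq> carrier G" by (rule subgroup.subset[OF sB])
    show "card (U <#> ?L) = p ^ u * card ?L"
      using card_set_mult_lower_p_series[OF p fin sU, of 2] u[OF U] by (simp add: numeral_2_eq_2)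
  qed
  moreover have "finite {B. subgroup B G \<and> ?L \<subseteq> B \<and> B \<subseteq> carrier G \<and> card B = p ^ u * card ?L}"
    by (rule finite_subset[of _ "Pow (carrier G)"]) (use fin in auto)
  ultimately show ?thesis by (meson card_mono order_trans)
qed

end

theorem theorem5p1:
  fixes G :: "('a, 'b) monoid_scheme" and p n :: nat
    and g :: "nat \<Rightarrow> nat" and u v w :: "nat \<Rightarrow> int"
  assumes "Factorial_Ring.prime p"
    and "group G" and "finite (carrier G)" and "\<exists>k::nat. order G = p ^ k"
    and "lower_p_length G p n"
    and "\<And>i. i \<in> {1..n} \<Longrightarrow>
           g i = section_dim G p (lower_p_series G p i) (lower_p_series G p (i + 1))"
    and "\<And>i. i \<in> {1..n} \<Longrightarrow> 0 \<le> u i \<and> u i \<le> int (g i)"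
    and "\<And>U i. U \<in> normal_subgroups_with_layers G p n u \<Longrightarrow> i \<in> {1..n} \<Longrightarrow>
           int (layer_dim G p (lower_p_series (G\<lparr>carrier := U\<rparr>) p 2) i) \<ge> v i"
    and "\<And>U i. U \<in> normal_subgroups_with_layers G p n u \<Longrightarrow> i \<in> {1..n} \<Longrightarrow>
           int (layer_dim G p (power_commutator G p U (carrier G)) i) \<ge> w i"
  shows "real (card (normal_subgroups_with_layers G p n u)) \<le>
    real (gaussian_coeff p (int (g 1)) (u 1)) *
    (\<Prod>i=2..n. real (gaussian_coeff p (int (g i) - w i) (u i - w i)) *
       real p powi ((int (g i) - u i) * ((\<Sum>j=1..i-1. u j) - (\<Sum>j=1..i-1. v j))))"
proof -
  interpret group G by fact
  note p = assms(1) and fin = assms(3) and g = assms(6) and u0 = assms(7)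
  let ?L = "lower_p_series G p"
  define S where "S = normal_subgroups_with_layers G p n u"
  define f where "f i = real (gaussian_coeff p (int (g i) - w i) (u i - w i)) *
       real p powi ((int (g i) - u i) * ((\<Sum>j=1..i-1. u j) - (\<Sum>j=1..i-1. v j)))" for i
  have n1: "1 \<le> n" and L_triv: "?L (Suc n) = {\<one>\<^bsub>G\<^esub>}"
    using assms(5) by (auto simp: lower_p_length_def)
  have nS: "U \<lhd> G" if "U \<in> S" for U
    using that by (simp add: S_def normal_subgroups_with_layers_def)
  have u: "layer_dim G p U i = nat (u i)" if "U \<in> S" "i \<in> {1..n}" for U i
  proof -
    have "int (layer_dim G p U i) = u i"
      using that by (auto simp: S_def normal_subgroups_with_layers_def)
    then show ?thesis by simp
  qed
  have v: "v i \<le> int (layer_dim G p (power_commutator G p U U) i)"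
    if "U \<in> S" "i \<in> {1..n}" for U i
    using assms(8)[OF that[unfolded S_def]]
      lower_p_series_2_restrict[OF normal_imp_subgroup[OF nS[OF that(1)]]] by simp
  have w: "w i \<le> int (layer_dim G p (power_commutator G p U (carrier G)) i)"
    if "U \<in> S" "i \<in> {1..n}" for U i
    using assms(9)[OF that[unfolded S_def]] .
  have "real (card ((\<lambda>U. U <#>\<^bsub>G\<^esub> ?L (Suc i)) ` S)) \<le>
      real (gaussian_coeff p (int (g 1)) (u 1)) * (\<Prod>k=2..i. f k)"
    if "1 \<le> i" "i \<le> n" for i
    using that
  proof (induction i rule: nat_induct_at_least)
    case base
    have "card ((\<lambda>U. U <#>\<^bsub>G\<^esub> ?L 2) ` S) \<le> gaussian_coeff p (int (g 1)) (int (nat (u 1)))"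
      using g[of 1] n1 u nS by (intro card_images_base[OF p fin]) (auto simp: numeral_2_eq_2)
    then show ?case using u0[of 1] n1 by (simp add: numeral_2_eq_2)
  next
    case (Suc i)
    have "real (card ((\<lambda>U. U <#>\<^bsub>G\<^esub> ?L (Suc (Suc i))) ` S)) \<le>
        real (card ((\<lambda>U. U <#>\<^bsub>G\<^esub> ?L (Suc i)) ` S)) *
        (real (gaussian_coeff p (int (g (Suc i)) - w (Suc i)) (int (nat (u (Suc i))) - w (Suc i))) *
         real p powi ((int (g (Suc i)) - int (nat (u (Suc i)))) *
           (\<Sum>j=1..<Suc i. int (nat (u j)) - v j)))"
      using g[of "Suc i"] Suc.prems u v w nS
      by (intro card_images_step[OF p fin]) auto
    also have "(\<Sum>j=1..<Suc i. int (nat (u j)) - v j) = (\<Sum>j=1..Suc i-1. u j) - (\<Sum>j=1..Suc i-1. v j)"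
      using u0 Suc.prems by (simp add: sum_subtractf atLeastLessThanSuc_atLeastAtMost)
    also have "int (nat (u (Suc i))) = u (Suc i)" using u0[of "Suc i"] Suc.prems by simp
    also have "real (gaussian_coeff p (int (g (Suc i)) - w (Suc i)) (u (Suc i) - w (Suc i))) *
         real p powi ((int (g (Suc i)) - u (Suc i)) *
           ((\<Sum>j=1..Suc i-1. u j) - (\<Sum>j=1..Suc i-1. v j))) = f (Suc i)"
      by (simp only: f_def)
    also have "real (card ((\<lambda>U. U <#>\<^bsub>G\<^esub> ?L (Suc i)) ` S)) * f (Suc i) \<le>
        real (gaussian_coeff p (int (g 1)) (u 1)) * (\<Prod>k=2..i. f k) * f (Suc i)"
      using Suc by (intro mult_right_mono) (auto simp: f_def)
    also have "\<dots> = real (gaussian_coeff p (int (g 1)) (u 1)) * (\<Prod>k=2..Suc i. f k)"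
      using Suc.hyps by (simp add: prod.nat_ivl_Suc' mult_ac)
    finally show ?case .
  qed
  \<comment> \<open>The last term of the chain is \<open>UG\<^sub>n\<^sub>+\<^sub>1 = U\<close>, because \<open>G\<^sub>n\<^sub>+\<^sub>1\<close> is trivial.\<close>
  from this[of n] have "real (card ((\<lambda>U. U <#>\<^bsub>G\<^esub> {\<one>\<^bsub>G\<^esub>}) ` S)) \<le>
      real (gaussian_coeff p (int (g 1)) (u 1)) * (\<Prod>k=2..n. f k)"
    using n1 L_triv by simp
  moreover have "U <#>\<^bsub>G\<^esub> {\<one>\<^bsub>G\<^esub>} = U" if "U \<in> S" for U
    using coset_mult_one[OF subgroup.subset[OF normal_imp_subgroup[OF nS[OF that]]]]
    by (simp add: r_coset_eq_set_mult)
  ultimately show ?thesis unfolding S_def[symmetric] f_def[symmetric] by simp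
qed

end
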